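(* Let $k\in\mathbb{N}$ and $n_1,\dots,n_k\in\{2,3,4,\dots\}$ with $n_1-1\mid n_j-1$ for all $j\in\{1,\dots,k\}$. Let $R(T)$ denote the subtree of a tree $T$ consisting entirely of carets with an edge on the right side of the tree. For any positive $(n_1,\dots,n_k)$-ary tree-pair diagram $(T_-,T_+)$, the positive word $w\in F(n_1,\dots,n_k)$ which $(T_-,T_+)$ represents can be written in the form $$(y_{\delta_1})_{\beta_1}\cdots(y_{\delta_N})_{\beta_N}(z_{\epsilon_1})_{\alpha_1}^{e_1}\cdots(z_{\epsilon_M})_{\alpha_M}^{e_M}$$ where $\beta_{i+1}\ge(n_{\delta_i}-1)+\beta_i$, $\alpha_{i+1}\ge\alpha_i$, and $\epsilon_i\ne\epsilon_{i+1}$, for all $i$. The procedure is as follows. (1) For $(y_{\delta_1})_{\beta_1}\cdots(y_{\delta_N})_{\beta_N}$: consider $R(T_+)$; let $N$ be the number of non-$n_1$-ary carets in $R(T_+)$, and let $\wedge_{\beta_i}$ denote the non-$n_1$-ary caret with leftmost leaf index number $(n_1-1)\beta_i$ in $R(T_+)$, with type $n_{\delta_i}$. (2) For $(z_{\epsilon_1})_{\alpha_1}^{e_1}\cdots(z_{\epsilon_M})_{\alpha_M}^{e_M}$: consider all of the carets in $T_+$ which are not in $R(T_+)$; let $M$ be the number of carets in $T_+$ which have non-empty leaf exponent matrices, and let $l_{\alpha_i}$ denote the leaf with nonempty leaf exponent matrix $\begin{pmatrix}\epsilon_i&\cdots&\epsilon_{i+m}\\ e_i&\cdots&e_{i+m}\end{pmatrix}$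 and index number $\alpha_i$. Then $\alpha_i=\alpha_{i+1}$ if and only if $l_{\alpha_i}$ has a leaf exponent matrix of the form $\begin{pmatrix}\cdots&\epsilon_i&\epsilon_{i+1}&\cdots\\ \cdots&e_i&e_{i+1}&\cdots\end{pmatrix}$. When $(T_-,T_+)$ is the unique minimal tree-pair diagram representative of $w$, this algebraic expression is the unique normal form of $w$.
   Context: $F(n_1,\dots,n_k)$ is the group of piecewise-linear orientation-preserving homeomorphisms of $[0,1]$ with finitely many breakpoints, all in $\mathbb{Z}[\frac{1}{n_1\cdots n_k}]$, and slopes in the multiplicative group $\langle n_1,\dots,n_k\rangle$; the product $xy$ is $x\circ y$. Trees. An $n$-ary caret (caret of type $n$) has one parent vertex joined by $n$ edges to $n$ child vertices, ordered from left to right. An $(n_1,\dots,n_k)$-ary tree is formed from finitely many carets of types in $\{n_1,\dots,n_k\}$ by identifying child vertices of carets with parent vertices of other carets. Leaves are numbered $0,1,2,\dots$ from left to right. The root represents $[0,1]$, and the children of an $n$-ary caret represent, from left to right, the $n$ equal consecutive closed subintervals of the parent's interval. A tree-pair diagram $(T_-,T_+)$ is an ordered pair of such trees with equally many leaves ($T_-$ the domain tree, $T_+$ the range tree); it represents the element mapping the $i$th leaf interval of $T_-$ affinely and increasingly onto the $i$th leaf interval of $T_+$, for all $i$. It is minimal if it has the fewest leaves among all diagrams representing the same element. A caret is a right caret if it has an edge on the right side (the rightmost root-to-leaf path) of the tree. A tree-pair diagram is positive if its domain tree contains only carets of type $n_1$ which are on the right side of the tree. Positive words are precisely those with positive tree-pair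 diagram representatives. Generators. A right $n_1$-string is a tree all of whose carets are right carets of type $n_1$. For $j\in\{2,\dots,k\}$ and $i\ge0$, $(y_j)_i$ is the element with range tree a right $n_1$-string of $i$ carets with an $n_j$-ary caret attached to its last leaf, and domain tree the right $n_1$-string with the same number of leaves. For $j\in\{1,\dots,k\}$ and $i\ge0$, $(z_j)_i$ is the element with range tree a right $n_1$-string of $\lfloor i/(n_1-1)\rfloor+1$ carets with an $n_j$-ary caret attached to the leaf numbered $i$, and domain tree the right $n_1$-string with the same number of leaves. Leaf exponent matrix. For a leaf $l_i$ of a tree $T$, let $\eta_i$ be the minimal path from $l_i$ to the root. Let $\lambda_i$ be the subpath of $\eta_i$ which begins at $l_i$ and moves along $\eta_i$ only as far as possible along edges which are the leftmost edge of some non-right caret; if no such movement is possible, $\lambda_i$ is empty. Break $\lambda_i$ into subpaths $\lambda_{i,1},\dots,\lambda_{i,r}$, each the maximal subpath containing one caret type, ordered so that $\lambda_{i,1}$ is closest to the root. The leaf exponent matrix of $l_i$ is the two-row matrix whose $j$th column has as top entry the type of the carets on $\lambda_{i,j}$ and as bottom entry the number of carets on $\lambda_{i,j}$; it is empty if $\lambda_i$ is empty. In the theorem, a top entry written $\epsilon_i$ stands for the caret type $n_{\epsilon_i}$, the subscript $\epsilon_i$ being the one used in $(z_{\epsilon_i})_{\alpha_i}$. Unique minimal representative. Order the carets of a tree level by level from top to bottom, and from left to right within a level. Order the minimal diagrams representing a given element by: $(T_-,T_+)<(S_-,S_+)$ if the first non-matching caret type in the domain trees is smaller in $T_-$ than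 in $S_-$, or if the domain trees are identical and the first non-matching caret type in the range trees is smaller in $T_+$ than in $S_+$. The unique minimal tree-pair diagram representative of an element is the first of its minimal diagrams in this ordering.
   Formalization: The spacing is corrected to (n_1-1)β_{i+1} ≥ (n_{δ_i}-1)+(n_1-1)β_i (the printed bound fails in F(3,5), agrees for n_1=2), and ε_i≠ε_{i+1} is required only when α_i=α_{i+1} (the printed one fails for (z_1)_0(z_1)_1 in F(2)). *)

theory Defs
  imports "HOL-Analysis.Analysis" "HOL-Algebra.Group"
begin

text \<open>
  Throughout, \<open>n 1, \<dots>, n k\<close> are the parameters of \<open>F(n\<^sub>1,\<dots>,n\<^sub>k)\<close>; values of \<open>n\<close> outside
  \<open>{1..k}\<close> are irrelevant.
\<close>

section \<open>The group\<close>

definition slope_group :: "(nat \<Rightarrow> nat) \<Rightarrow> nat \<Rightarrow> real set" where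
  "slope_group n k = range (\<lambda>a :: nat \<Rightarrow> int. \<Prod>j\<in>{1..k}. real (n j) powi a j)"

definition break_ring :: "(nat \<Rightarrow> nat) \<Rightarrow> nat \<Rightarrow> real set" where
  "break_ring n k = {of_int c / real (\<Prod>j\<in>{1..k}. n j) ^ m | (c :: int) (m :: nat). True}"

text \<open>
  A homeomorphism of \<open>[0,1]\<close> is encoded as a function on the reals which is the identity outside
  \<open>[0,1]\<close>, so that the group product is plain composition. The set \<open>P\<close> contains the breakpoints.
\<close>

definition thompson :: "(nat \<Rightarrow> nat) \<Rightarrow> nat \<Rightarrow> (real \<Rightarrow> real) monoid" where
  "thompson n k =
    \<lparr>carrier = {f. (\<forall>x. x \<notin> {0..1} \<longrightarrow> f x = x) \<and>
        (\<exists>g. homeomorphism {0..1} {0..1} f g) \<and> strict_mono_on {0..1} f \<and>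
        (\<exists>P. finite P \<and> P \<subseteq> break_ring n k \<and>
          (\<forall>a b. 0 \<le> a \<and> a < b \<and> b \<le> 1 \<and> {a<..<b} \<inter> P = {} \<longrightarrow>
            (\<exists>m\<in>slope_group n k. \<exists>c. \<forall>x\<in>{a..b}. f x = m * x + c)))},
     mult = (\<lambda>f g. f \<circ> g), one = id\<rparr>"

section \<open>Trees\<close>

text \<open>The type of a caret is the length of its list of children.\<close>

datatype tree = Leaf | Caret "tree list"

lemma size_nth_child [termination_simp]:
  "i < length ts \<Longrightarrow> size (ts ! i) < Suc (size_list size ts)"
  by (meson le_imp_less_Suc nth_mem order_refl size_list_estimation')

fun is_tree :: "(nat \<Rightarrow> nat) \<Rightarrow> nat \<Rightarrow> tree \<Rightarrow> bool" where
  "is_tree n k Leaf = True"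
| "is_tree n k (Caret ts) = (length ts \<in> n ` {1..k} \<and> (\<forall>t\<in>set ts. is_tree n k t))"

fun num_leaves :: "tree \<Rightarrow> nat" where
  "num_leaves Leaf = 1"
| "num_leaves (Caret ts) = sum_list (map num_leaves ts)"

fun leaf_intervals :: "real \<Rightarrow> real \<Rightarrow> tree \<Rightarrow> (real \<times> real) list" where
  "leaf_intervals a b Leaf = [(a, b)]"
| "leaf_intervals a b (Caret ts) =
    (let h = (b - a) / real (length ts)
     in concat (map (\<lambda>i. leaf_intervals (a + real i * h) (a + real (Suc i) * h) (ts ! i))
                  [0..<length ts]))"

text \<open>
  \<open>leaf_paths True T\<close> lists, for the leaves from left to right, the path from the root to the leaf.
  An edge is recorded as (type of the caret, position of the child, whether the caret is a right
  caret); the Boolean argument says whether the root of the current subtree lies on the right side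
  of the whole tree.
\<close>

fun leaf_paths :: "bool \<Rightarrow> tree \<Rightarrow> (nat \<times> nat \<times> bool) list list" where
  "leaf_paths r Leaf = [[]]"
| "leaf_paths r (Caret ts) =
    concat (map (\<lambda>i. map (Cons (length ts, i, r)) (leaf_paths (r \<and> Suc i = length ts) (ts ! i)))
      [0..<length ts])"

text \<open>\<open>right_part T\<close> is the tree \<open>R(T)\<close>.\<close>

fun right_part :: "tree \<Rightarrow> tree" where
  "right_part Leaf = Leaf"
| "right_part (Caret ts) =
    Caret (map (\<lambda>i. if Suc i = length ts then right_part (ts ! i) else Leaf) [0..<length ts])"

text \<open>
  The carets of a tree, each as (type, number of its leftmost leaf); a parent precedes its
  descendants, and siblings are listed from left to right. The first argument is the number of the
  leftmost leaf of the current subtree.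
\<close>

fun carets_with_leaf :: "nat \<Rightarrow> tree \<Rightarrow> (nat \<times> nat) list" where
  "carets_with_leaf s Leaf = []"
| "carets_with_leaf s (Caret ts) =
    (length ts, s) #
    concat (map (\<lambda>i. carets_with_leaf (s + (\<Sum>j<i. num_leaves (ts ! j))) (ts ! i))
      [0..<length ts])"

fun height :: "tree \<Rightarrow> nat" where
  "height Leaf = 0"
| "height (Caret ts) = Suc (foldr max (map height ts) 0)"

fun level_types :: "nat \<Rightarrow> tree \<Rightarrow> nat list" where
  "level_types d Leaf = []"
| "level_types 0 (Caret ts) = [length ts]"
| "level_types (Suc d) (Caret ts) = concat (map (level_types d) ts)"

definition caret_types :: "tree \<Rightarrow> nat list" where
  "caret_types T = concat (map (\<lambda>d. level_types d T) [0..<height T])"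

section \<open>Tree-pair diagrams\<close>

text \<open>A diagram is the pair (domain tree, range tree).\<close>

definition is_diagram :: "(nat \<Rightarrow> nat) \<Rightarrow> nat \<Rightarrow> tree \<times> tree \<Rightarrow> bool" where
  "is_diagram n k D \<longleftrightarrow>
    is_tree n k (fst D) \<and> is_tree n k (snd D) \<and> num_leaves (fst D) = num_leaves (snd D)"

definition represents :: "tree \<times> tree \<Rightarrow> (real \<Rightarrow> real) \<Rightarrow> bool" where
  "represents D f \<longleftrightarrow>
    (\<forall>x. x \<notin> {0..1} \<longrightarrow> f x = x) \<and>
    (\<forall>i<num_leaves (fst D).
      let (a, b) = leaf_intervals 0 1 (fst D) ! i;
          (c, d) = leaf_intervals 0 1 (snd D) ! i
      in \<forall>x\<in>{a..b}. f x = c + (d - c) / (b - a) * (x - a))"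

definition diagram_element :: "tree \<times> tree \<Rightarrow> (real \<Rightarrow> real)" where
  "diagram_element D = (THE f. represents D f)"

text \<open>Every caret lies on the path of some leaf, so this ranges over all carets of the domain tree.\<close>

definition is_positive :: "(nat \<Rightarrow> nat) \<Rightarrow> nat \<Rightarrow> tree \<times> tree \<Rightarrow> bool" where
  "is_positive n k D \<longleftrightarrow> is_diagram n k D \<and>
    (\<forall>p\<in>set (leaf_paths True (fst D)). \<forall>(m, i, r)\<in>set p. m = n 1 \<and> r)"

definition is_minimal :: "(nat \<Rightarrow> nat) \<Rightarrow> nat \<Rightarrow> (real \<Rightarrow> real) \<Rightarrow> tree \<times> tree \<Rightarrow> bool" where
  "is_minimal n k w D \<longleftrightarrow> is_diagram n k D \<and> represents D w \<and>
    (\<forall>E. is_diagram n k E \<and> represents E w \<longrightarrow> num_leaves (fst D) \<le> num_leaves (fst E))"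

definition tree_less :: "tree \<Rightarrow> tree \<Rightarrow> bool" where
  "tree_less S T \<longleftrightarrow>
    (\<exists>i. i < length (caret_types S) \<and> i < length (caret_types T) \<and>
      take i (caret_types S) = take i (caret_types T) \<and> caret_types S ! i < caret_types T ! i)"

definition diagram_less :: "tree \<times> tree \<Rightarrow> tree \<times> tree \<Rightarrow> bool" where
  "diagram_less D E \<longleftrightarrow>
    tree_less (fst D) (fst E) \<or> (fst D = fst E \<and> tree_less (snd D) (snd E))"

definition is_unique_minimal ::
    "(nat \<Rightarrow> nat) \<Rightarrow> nat \<Rightarrow> (real \<Rightarrow> real) \<Rightarrow> tree \<times> tree \<Rightarrow> bool" where
  "is_unique_minimal n k w D \<longleftrightarrow> is_minimal n k w D \<and>
    (\<forall>E. is_minimal n k w E \<and> E \<noteq> D \<longrightarrow> diagram_less D E)"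

section \<open>Generators\<close>

fun right_string :: "nat \<Rightarrow> nat \<Rightarrow> tree" where
  "right_string m 0 = Leaf"
| "right_string m (Suc c) = Caret (replicate (m - 1) Leaf @ [right_string m c])"

definition caret :: "nat \<Rightarrow> tree" where
  "caret m = Caret (replicate m Leaf)"

text \<open>\<open>attach U i T\<close> attaches \<open>U\<close> to the leaf of \<open>T\<close> with number \<open>i\<close>.\<close>

fun attach :: "tree \<Rightarrow> nat \<Rightarrow> tree \<Rightarrow> tree"
  and attach_list :: "tree \<Rightarrow> nat \<Rightarrow> tree list \<Rightarrow> tree list" where
  "attach U i Leaf = (if i = 0 then U else Leaf)"
| "attach U i (Caret ts) = Caret (attach_list U i ts)"
| "attach_list U i [] = []"
| "attach_list U i (t # ts) =
    (if i < num_leaves t then attach U i t # ts else t # attach_list U (i - num_leaves t) ts)"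

text \<open>
  A right \<open>n\<^sub>1\<close>-string with \<open>c\<close> carets has \<open>c (n\<^sub>1 - 1) + 1\<close> leaves; the division is exact for
  \<open>(n\<^sub>1,\<dots>,n\<^sub>k)\<close>-ary trees when \<open>n\<^sub>1 - 1\<close> divides every \<open>n\<^sub>j - 1\<close>.
\<close>

definition string_like :: "(nat \<Rightarrow> nat) \<Rightarrow> tree \<Rightarrow> tree" where
  "string_like n T = right_string (n 1) ((num_leaves T - 1) div (n 1 - 1))"

definition gen_y :: "(nat \<Rightarrow> nat) \<Rightarrow> nat \<Rightarrow> nat \<Rightarrow> (real \<Rightarrow> real)" where
  "gen_y n j i =
    (let R = right_string (n 1) i;
         T = attach (caret (n j)) (num_leaves R - 1) R
     in diagram_element (string_like n T, T))"

definition gen_z :: "(nat \<Rightarrow> nat) \<Rightarrow> nat \<Rightarrow> nat \<Rightarrow> (real \<Rightarrow> real)" where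
  "gen_z n j i =
    (let T = attach (caret (n j)) i (right_string (n 1) (i div (n 1 - 1) + 1))
     in diagram_element (string_like n T, T))"

section \<open>Leaf exponent matrices\<close>

lemma length_dropWhile_less [termination_simp]:
  "length (dropWhile P xs) < Suc (length xs)"
  by (simp add: length_dropWhile_le less_Suc_eq_le)

fun runs :: "'a list \<Rightarrow> ('a \<times> nat) list" where
  "runs [] = []"
| "runs (x # xs) =
    (x, Suc (length (takeWhile (\<lambda>y. y = x) xs))) # runs (dropWhile (\<lambda>y. y = x) xs)"

text \<open>
  The list of columns (caret type, number of carets). The path \<open>\<lambda>\<^sub>i\<close> is traversed upwards from the
  leaf, whereas the first column belongs to the part closest to the root.
\<close>

definition leaf_exponent_matrix :: "tree \<Rightarrow> nat \<Rightarrow> (nat \<times> nat) list" where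
  "leaf_exponent_matrix T l =
    runs (rev (map fst
      (takeWhile (\<lambda>(m, i, r). i = 0 \<and> \<not> r) (rev (leaf_paths True T ! l)))))"

section \<open>Words and the normal form\<close>

text \<open>
  An expression \<open>(y\<^bsub>\<delta>1\<^esub>)\<^bsub>\<beta>1\<^esub> \<cdots> (y\<^bsub>\<delta>N\<^esub>)\<^bsub>\<beta>N\<^esub> (z\<^bsub>\<epsilon>1\<^esub>)\<^bsub>\<alpha>1\<^esub>^e\<^sub>1 \<cdots> (z\<^bsub>\<epsilon>M\<^esub>)\<^bsub>\<alpha>M\<^esub>^e\<^sub>M\<close> is given by the list \<open>ys\<close> of the
  pairs \<open>(\<delta>\<^sub>i, \<beta>\<^sub>i)\<close> and the list \<open>zs\<close> of the triples \<open>(\<epsilon>\<^sub>i, \<alpha>\<^sub>i, e\<^sub>i)\<close>.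
\<close>

type_synonym y_word = "(nat \<times> nat) list"
type_synonym z_word = "(nat \<times> nat \<times> nat) list"

definition word_value :: "(nat \<Rightarrow> nat) \<Rightarrow> nat \<Rightarrow> y_word \<Rightarrow> z_word \<Rightarrow> (real \<Rightarrow> real)" where
  "word_value n k ys zs =
    foldr (mult (thompson n k))
      (map (\<lambda>(\<delta>, \<beta>). gen_y n \<delta> \<beta>) ys @
       map (\<lambda>(\<epsilon>, \<alpha>, e). gen_z n \<epsilon> \<alpha> [^]\<^bsub>thompson n k\<^esub> e) zs)
      \<one>\<^bsub>thompson n k\<^esub>"

text \<open>
  The index \<open>\<beta>\<close> counts \<open>n\<^sub>1\<close>-ary carets, each of which contributes \<open>n\<^sub>1 - 1\<close> leaves to a right
  string, while a caret of type \<open>n\<^sub>\<delta>\<close> contributes \<open>n\<^sub>\<delta> - 1\<close> leaves. Hence the spacing condition is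
  \<open>\<beta>\<^bsub>i+1\<^esub> \<ge> \<beta>\<^sub>i + (n\<^bsub>\<delta>i\<^esub> - 1) / (n\<^sub>1 - 1)\<close>, written here without division; for \<open>n\<^sub>1 = 2\<close> it reads
  \<open>\<beta>\<^bsub>i+1\<^esub> \<ge> (n\<^bsub>\<delta>i\<^esub> - 1) + \<beta>\<^sub>i\<close>. The condition \<open>\<epsilon>\<^sub>i \<noteq> \<epsilon>\<^bsub>i+1\<^esub>\<close> concerns neighbouring powers with the
  same index \<open>\<alpha>\<close>, which could otherwise be merged into one.
\<close>

definition word_form :: "(nat \<Rightarrow> nat) \<Rightarrow> nat \<Rightarrow> y_word \<Rightarrow> z_word \<Rightarrow> bool" where
  "word_form n k ys zs \<longleftrightarrow>
    (\<forall>(\<delta>, \<beta>)\<in>set ys. \<delta> \<in> {2..k}) \<and>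
    (\<forall>(\<epsilon>, \<alpha>, e)\<in>set zs. \<epsilon> \<in> {1..k} \<and> e \<ge> 1) \<and>
    (\<forall>i. Suc i < length ys \<longrightarrow>
      (let (\<delta>, \<beta>) = ys ! i; (\<delta>', \<beta>') = ys ! Suc i
       in (n 1 - 1) * \<beta>' \<ge> (n \<delta> - 1) + (n 1 - 1) * \<beta>)) \<and>
    (\<forall>i. Suc i < length zs \<longrightarrow>
      (let (\<epsilon>, \<alpha>, e) = zs ! i; (\<epsilon>', \<alpha>', e') = zs ! Suc i
       in \<alpha>' \<ge> \<alpha> \<and> (\<alpha> = \<alpha>' \<longrightarrow> \<epsilon> \<noteq> \<epsilon>')))"

text \<open>
  The subscript \<open>j\<close> with \<open>n\<^sub>j = t\<close>. The parameters are not assumed to be distinct; if a value is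
  repeated, the carets of that type are always named by the smallest subscript.
\<close>

definition subscript :: "(nat \<Rightarrow> nat) \<Rightarrow> nat \<Rightarrow> nat \<Rightarrow> nat" where
  "subscript n k t = (LEAST j. j \<in> {1..k} \<and> n j = t)"

text \<open>
  The \<open>i\<close>th entry \<open>(\<delta>\<^sub>i, \<beta>\<^sub>i)\<close> of \<open>ys\<close> belongs to the \<open>i\<close>th caret of \<open>R(T)\<close>, from the root downwards,
  that is not \<open>n\<^sub>1\<close>-ary: its type is \<open>n\<^bsub>\<delta>i\<^esub>\<close> and its leftmost leaf in \<open>R(T)\<close> has number
  \<open>(n\<^sub>1 - 1) \<beta>\<^sub>i\<close>.
\<close>

definition y_procedure :: "(nat \<Rightarrow> nat) \<Rightarrow> nat \<Rightarrow> tree \<Rightarrow> y_word \<Rightarrow> bool" where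
  "y_procedure n k T ys \<longleftrightarrow>
    map (\<lambda>(\<delta>, \<beta>). (\<delta>, (n 1 - 1) * \<beta>)) ys =
    map (\<lambda>(t, l). (subscript n k t, l))
      (filter (\<lambda>(t, l). t \<noteq> n 1) (carets_with_leaf 0 (right_part T)))"

text \<open>
  The entries \<open>(\<epsilon>\<^sub>i, \<alpha>\<^sub>i, e\<^sub>i)\<close> of \<open>zs\<close> are the columns of all leaf exponent matrices, leaf by leaf from
  left to right.
\<close>

definition z_procedure :: "(nat \<Rightarrow> nat) \<Rightarrow> nat \<Rightarrow> tree \<Rightarrow> z_word \<Rightarrow> bool" where
  "z_procedure n k T zs \<longleftrightarrow>
    zs = concat (map (\<lambda>l. map (\<lambda>(t, e). (subscript n k t, l, e)) (leaf_exponent_matrix T l))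
      [0..<num_leaves T])"

text \<open>
  \<open>adjacent_columns n k T zs i\<close>: the leaf numbered \<open>\<alpha>\<^sub>i\<close> has a leaf exponent matrix in which the
  columns with the indices \<open>i\<close> and \<open>i + 1\<close> are adjacent. The columns of the matrices are indexed
  consecutively from left to right through all leaves. Without the index equation a pair of
  adjacent columns elsewhere in the matrix that accidentally has the same entries would qualify.
\<close>

definition adjacent_columns :: "(nat \<Rightarrow> nat) \<Rightarrow> nat \<Rightarrow> tree \<Rightarrow> z_word \<Rightarrow> nat \<Rightarrow> bool" where
  "adjacent_columns n k T zs i \<longleftrightarrow>
    (let (\<epsilon>, \<alpha>, e) = zs ! i; (\<epsilon>', \<alpha>', e') = zs ! Suc i
     in \<exists>us vs. leaf_exponent_matrix T \<alpha> = us @ [(n \<epsilon>, e), (n \<epsilon>', e')] @ vs \<and>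
          i = (\<Sum>l<\<alpha>. length (leaf_exponent_matrix T l)) + length us)"

text \<open>
  An element may have several expressions satisfying \<open>word_form\<close>; its normal form is the one read
  off from its unique minimal tree-pair diagram representative.
\<close>

definition is_normal_form ::
    "(nat \<Rightarrow> nat) \<Rightarrow> nat \<Rightarrow> (real \<Rightarrow> real) \<Rightarrow> y_word \<Rightarrow> z_word \<Rightarrow> bool" where
  "is_normal_form n k w ys zs \<longleftrightarrow>
    word_form n k ys zs \<and> word_value n k ys zs = w \<and>
    (\<exists>D. is_unique_minimal n k w D \<and> is_positive n k D \<and>
      y_procedure n k (snd D) ys \<and> z_procedure n k (snd D) zs)"

end

theory Submission
  imports Defs
begin

text \<open>
  If \<open>f\<close> is represented by \<open>(S, T)\<close> with \<open>S\<close> a right \<open>n\<^sub>1\<close>-string, then \<open>f \<circ> (z\<^sub>j)\<^sub>i\<close> is represented by a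
  longer string and \<open>T\<close> with an \<open>n\<^sub>j\<close>-ary caret attached to its leaf \<open>i\<close>, provided that this leaf is not
  the last one; right multiplication by \<open>(y\<^sub>j)\<^sub>i\<close> in the same way attaches a caret to the last leaf. So
  the \<open>y\<close>-part of the word grows \<open>R(T)\<close> from the root, and the \<open>z\<close>-part then attaches the remaining carets
  in preorder. Attaching a caret does not renumber the leaves up to its own leftmost leaf, hence in
  preorder each caret is attached at a leaf which already has its final number; grouping the carets
  by these numbers gives the leaf exponent matrices. The effect of attaching a tree is local: it refines
  one interval of the list of leaf intervals, and an affine map carries a refinement of its domain to
  the same refinement of its image.
\<close>

section \<open>Leaf intervals\<close>

text \<open>A caret without children would have no leaf intervals and leave a gap in [0,1]; this is
  what \<open>proper\<close> excludes.\<close>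

fun proper :: "tree \<Rightarrow> bool" where
  "proper Leaf = True"
| "proper (Caret ts) = (ts \<noteq> [] \<and> (\<forall>t\<in>set ts. proper t))"

text \<open>The step \<open>h\<close> is fixed in advance, so that claims about the children of a
  caret can be proved by induction on a list whose length need not match \<open>h\<close>.\<close>

fun subdivide :: "real \<Rightarrow> real \<Rightarrow> tree list \<Rightarrow> (real \<times> real) list" where
  "subdivide a h [] = []"
| "subdivide a h (t # ts) = leaf_intervals a (a + h) t @ subdivide (a + h) h ts"

lemma concat_leaf_intervals_eq_subdivide:
  "concat (map (\<lambda>i. leaf_intervals (a + real i * h) (a + real (Suc i) * h) (ts ! i))
     [0..<length ts]) = subdivide a h ts"
proof (induction ts arbitrary: a)
  case (Cons t ts)
  have "[0..<length (t # ts)] = 0 # map Suc [0..<length ts]"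
    by (simp add: map_Suc_upt upt_conv_Cons del: upt_Suc)
  then show ?case
    using Cons.IH[of "a + h"] by (simp add: o_def algebra_simps del: upt_Suc)
qed simp

lemma leaf_intervals_Caret:
  "leaf_intervals a b (Caret ts) = subdivide a ((b - a) / length ts) ts"
  by (simp add: Let_def concat_leaf_intervals_eq_subdivide del: of_nat_Suc)

declare leaf_intervals.simps(2) [simp del]

lemma subdivide_append:
  "subdivide a h (ts @ us) = subdivide a h ts @ subdivide (a + real (length ts) * h) h us"
  by (induction ts arbitrary: a) (simp_all add: algebra_simps)

lemma length_leaf_intervals [simp]: "length (leaf_intervals a b T) = num_leaves T"
proof (induction T arbitrary: a b)
  case (Caret ts)
  have "(\<And>t. t \<in> set us \<Longrightarrow> t \<in> set ts) \<Longrightarrow>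
      length (subdivide c h us) = sum_list (map num_leaves us)" for c h us
    by (induction us arbitrary: c) (auto simp: Caret)
  then show ?case by (simp add: leaf_intervals_Caret)
qed simp

lemma length_subdivide [simp]: "length (subdivide a h ts) = sum_list (map num_leaves ts)"
  by (induction ts arbitrary: a) auto

section \<open>Partitions of an interval into consecutive nondegenerate pieces\<close>

fun chain :: "real \<Rightarrow> real \<Rightarrow> (real \<times> real) list \<Rightarrow> bool" where
  "chain a b [] \<longleftrightarrow> a = b"
| "chain a b ((x, y) # L) \<longleftrightarrow> x = a \<and> x < y \<and> chain y b L"

lemma chain_append: "chain a b L \<Longrightarrow> chain b c M \<Longrightarrow> chain a c (L @ M)"
  by (induction a b L rule: chain.induct) auto

lemma chain_le: "chain a b L \<Longrightarrow> a \<le> b"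
  by (induction a b L rule: chain.induct) auto

lemma chain_less: "chain a b L \<Longrightarrow> (u, v) \<in> set L \<Longrightarrow> u < v"
  by (induction a b L rule: chain.induct) auto

lemma chain_bounds: "chain a b L \<Longrightarrow> (u, v) \<in> set L \<Longrightarrow> a \<le> u \<and> v \<le> b"
  by (induction a b L rule: chain.induct) (fastforce dest: chain_le)+

text \<open>The intervals of the children abut and share a positive length, so their chains
  concatenate.\<close>

lemma chain_leaf_intervals: "a < b \<Longrightarrow> proper T \<Longrightarrow> chain a b (leaf_intervals a b T)"
proof (induction T arbitrary: a b)
  case (Caret ts)
  define h where "h = (b - a) / length ts"
  have "ts \<noteq> []" using Caret.prems by simp
  then have h: "h > 0" "a + length ts * h = b" using Caret.prems by (auto simp: h_def)
  \<comment> \<open>The start point and the sublist vary while \<open>h\<close> stays that of the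
    whole caret; dropping a child must not change the step.\<close>
  have "set us \<subseteq> set ts \<Longrightarrow> chain c (c + length us * h) (subdivide c h us)" for c us
  proof (induction us arbitrary: c)
    case (Cons u us)
    have "chain c (c + h) (leaf_intervals c (c + h) u)"
      using Cons.prems h Caret by auto
    moreover have "chain (c + h) (c + h + length us * h) (subdivide (c + h) h us)"
      using Cons by auto
    ultimately show ?case
      using chain_append by (fastforce simp: algebra_simps)
  qed simp
  from this[of ts a] show ?case
    using h(2) by (simp only: leaf_intervals_Caret h_def[symmetric])
qed simp

text \<open>An interval with no endpoint of a piece in its interior stays inside one piece, where
  the maps considered below are affine.\<close>

lemma chain_covers:
  assumes "chain p q L" "p \<le> a" "a < b" "b \<le> q"
    and "{a<..<b} \<inter> (fst ` set L \<union> snd ` set L) = {}"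
  shows "\<exists>(u, v)\<in>set L. u \<le> a \<and> b \<le> v"
  using assms
proof (induction p q L rule: chain.induct)
  case (2 p q x y L)
  show ?case
  proof (cases "y \<le> a")
    case True
    then have "\<exists>(u, v)\<in>set L. u \<le> a \<and> b \<le> v" using 2 by auto
    then show ?thesis by auto
  next
    case False
    then have "b \<le> y" using 2 by force
    then show ?thesis using 2 by auto
  qed
qed auto

lemma chain_covers_point:
  assumes "chain p q L" "p < q" "x \<in> {p..q}"
  shows "\<exists>(u, v)\<in>set L. x \<in> {u..v}"
  using assms
proof (induction p q L rule: chain.induct)
  case (2 p q u v L)
  show ?case
  proof (cases "x \<le> v")
    case False
    then have "\<exists>(u, v)\<in>set L. x \<in> {u..v}" using 2 by auto
    then show ?thesis by auto
  qed (use 2 in auto)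
qed auto

section \<open>Maps that are affine on the pieces of a partition\<close>

fun maps_onto :: "(real \<Rightarrow> real) \<Rightarrow> real \<times> real \<Rightarrow> real \<times> real \<Rightarrow> bool" where
  "maps_onto f (a, b) (c, d) \<longleftrightarrow>
    a < b \<and> c < d \<and> (\<forall>x\<in>{a..b}. f x = c + (d - c) / (b - a) * (x - a))"

text \<open>Lists of intervals replace trees here because a list can be split at a leaf and refined
  there without describing the resulting tree. The inequalities in \<open>maps_onto\<close> keep
  slopes positive and denominators nonzero.\<close>

definition carries ::
    "(real \<Rightarrow> real) \<Rightarrow> (real \<times> real) list \<Rightarrow> (real \<times> real) list \<Rightarrow> bool" where
  "carries f L M \<longleftrightarrow> (\<forall>x. x \<notin> {0..1} \<longrightarrow> f x = x) \<and> list_all2 (maps_onto f) L M"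

lemma maps_onto_ends: "maps_onto f (a, b) (c, d) \<Longrightarrow> f a = c \<and> f b = d"
  by (auto simp: field_simps)

lemma maps_onto_comp:
  assumes "maps_onto g I J" "maps_onto f J K"
  shows "maps_onto (f \<circ> g) I K"
proof -
  obtain a b c d p q where [simp]: "I = (a, b)" "J = (c, d)" "K = (p, q)"
    by (cases I, cases J, cases K)
  have less: "a < b" "c < d" "p < q" using assms by auto
  have "(f \<circ> g) x = p + (q - p) / (b - a) * (x - a)" if x: "x \<in> {a..b}" for x
  proof -
    have g: "g x = c + (d - c) / (b - a) * (x - a)" using assms x by auto
    \<comment> \<open>The relative position of \<open>x\<close> in [a,b], scaled by
      \<open>d - c\<close>, places \<open>g x\<close> in the interval where the formula for
      \<open>f\<close> is valid.\<close>
    have "0 \<le> (x - a) / (b - a)" "(x - a) / (b - a) \<le> 1" using x less by auto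
    then have "(d - c) * ((x - a) / (b - a)) \<in> {0..d - c}"
      using less mult_left_mono[of "(x - a) / (b - a)" 1 "d - c"]
        mult_nonneg_nonneg[of "d - c" "(x - a) / (b - a)"] by (simp del: times_divide_eq_right)
    then have "g x \<in> {c..d}" using g by (simp add: field_simps)
    then have "f (g x) = p + (q - p) / (d - c) * (g x - c)" using assms by auto
    also have "\<dots> = p + (q - p) / (b - a) * (x - a)" using g less by simp
    finally show ?thesis by simp
  qed
  then show ?thesis using less by simp
qed

lemma carries_comp: "carries f L M \<Longrightarrow> carries g K L \<Longrightarrow> carries (f \<circ> g) K M"
  unfolding carries_def
  by (auto elim: list_all2_trans[rotated] intro: maps_onto_comp)

lemma carries_length: "carries f L M \<Longrightarrow> length L = length M"
  by (auto simp: carries_def list_all2_lengthD)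

text \<open>Equal subdivision commutes with increasing affine maps: the step \<open>h\<close>
  becomes \<open>s * h\<close>. The slope \<open>s\<close> is explicit because it stays the same at
  all levels of the induction while the endpoints change.\<close>

lemma affine_leaf_intervals:
  assumes "a < b" "s > 0" "\<forall>x\<in>{a..b}. f x = c + s * (x - a)" "proper U"
  shows "list_all2 (maps_onto f) (leaf_intervals a b U) (leaf_intervals c (c + s * (b - a)) U)"
  using assms
proof (induction U arbitrary: a b c)
  case (Caret ts)
  define h where "h = (b - a) / length ts"
  have "ts \<noteq> []" using Caret.prems by simp
  then have h: "h > 0" "a + length ts * h = b" using Caret.prems by (auto simp: h_def)
  have "list_all2 (maps_onto f) (subdivide a' h us) (subdivide c' (s * h) us)"
    if "set us \<subseteq> set ts" "\<forall>x\<in>{a'..a' + length us * h}. f x = c' + s * (x - a')" for a' c' us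
    using that
  proof (induction us arbitrary: a' c')
    case (Cons u us)
    have nn: "0 \<le> length us * h" using h by simp
    have eq: "a' + real (length (u # us)) * h = a' + h + length us * h"
      by (simp add: algebra_simps)
    have f: "f x = c' + s * (x - a')" if "a' \<le> x" "x \<le> a' + h + length us * h" for x
      using Cons.prems(2) that unfolding eq by simp
    have "list_all2 (maps_onto f) (leaf_intervals a' (a' + h) u)
        (leaf_intervals c' (c' + s * (a' + h - a')) u)"
    proof (rule Caret.IH)
      show "\<forall>x\<in>{a'..a' + h}. f x = c' + s * (x - a')"
      proof
        fix x assume "x \<in> {a'..a' + h}"
        then have "a' \<le> x" "x \<le> a' + h" by auto
        then have "a' \<le> x" "x \<le> a' + h + length us * h" using nn by linarith+
        then show "f x = c' + s * (x - a')" by (rule f)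
      qed
    qed (use Cons.prems(1) Caret.prems h in auto)
    moreover have "list_all2 (maps_onto f) (subdivide (a' + h) h us)
        (subdivide (c' + s * h) (s * h) us)"
    proof (rule Cons.IH)
      show "\<forall>x\<in>{a' + h..a' + h + length us * h}. f x = c' + s * h + s * (x - (a' + h))"
        using h(1) f by (auto simp: algebra_simps)
    qed (use Cons.prems in auto)
    ultimately show ?case by (simp add: list_all2_appendI)
  qed simp
  from this[of ts a c] show ?case
    using Caret.prems h by (simp add: leaf_intervals_Caret h_def)
qed simp

lemma maps_onto_leaf_intervals:
  assumes "maps_onto f (a, b) (c, d)" "proper U"
  shows "list_all2 (maps_onto f) (leaf_intervals a b U) (leaf_intervals c d U)"
  using affine_leaf_intervals[of a b "(d - c) / (b - a)" f c U] assms by auto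

text \<open>The locality principle: refining two corresponding pieces by the same tree does not
  change the map. Equal prefix lengths say that the pieces correspond.\<close>

lemma carries_refine:
  assumes "carries f (P @ (a, b) # Q) (P' @ (c, d) # Q')" "length P = length P'" "proper U"
  shows "carries f (P @ leaf_intervals a b U @ Q) (P' @ leaf_intervals c d U @ Q')"
  using assms by (auto simp: carries_def list_all2_append maps_onto_leaf_intervals)

text \<open>The nondegeneracy that \<open>maps_onto\<close> asks for beyond
  \<open>represents\<close> is automatic for the leaf intervals of proper trees.\<close>

lemma represents_iff_carries:
  assumes "proper S" "proper T" "num_leaves S = num_leaves T"
  shows "represents (S, T) f \<longleftrightarrow> carries f (leaf_intervals 0 1 S) (leaf_intervals 0 1 T)"
proof -
  have "maps_onto f (leaf_intervals 0 1 S ! i) (leaf_intervals 0 1 T ! i) \<longleftrightarrow>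
      (let (a, b) = leaf_intervals 0 1 S ! i; (c, d) = leaf_intervals 0 1 T ! i
       in \<forall>x\<in>{a..b}. f x = c + (d - c) / (b - a) * (x - a))"
    if "i < num_leaves S" for i
  proof -
    have "fst (leaf_intervals 0 1 U ! i) < snd (leaf_intervals 0 1 U ! i)"
      if "proper U" "i < num_leaves U" for U
    proof (rule chain_less)
      show "chain 0 1 (leaf_intervals 0 1 U)" using that by (simp add: chain_leaf_intervals)
    qed (simp add: that)
    from this[of S] this[of T] show ?thesis
      using that assms
      by (cases "leaf_intervals 0 1 S ! i"; cases "leaf_intervals 0 1 T ! i") simp
  qed
  then show ?thesis
    using assms by (auto simp: represents_def carries_def list_all2_conv_all_nth)
qed

lemma carries_unique:
  assumes "carries f L M" "carries g L M" "chain 0 1 L"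
  shows "f = g"
proof
  fix x
  show "f x = g x"
  proof (cases "x \<in> {0..1}")
    case True
    then obtain u v where uv: "(u, v) \<in> set L" "x \<in> {u..v}"
      using chain_covers_point[OF assms(3) _ True] by auto
    then obtain i where i: "i < length L" "L ! i = (u, v)" by (auto simp: in_set_conv_nth)
    obtain c d where "M ! i = (c, d)" by fastforce
    then have "maps_onto f (u, v) (c, d)" "maps_onto g (u, v) (c, d)"
      using assms i by (auto simp: carries_def list_all2_conv_all_nth)
    then show ?thesis using uv by auto
  next
    case False
    then show ?thesis using assms by (simp add: carries_def)
  qed
qed

text \<open>The map is glued from the left; where two pieces meet, both formulas give the common
  endpoint.\<close>

lemma exists_maps_onto:
  assumes "chain a b L" "chain c d M" "length L = length M"
  shows "\<exists>f. list_all2 (maps_onto f) L M"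
  using assms
proof (induction L arbitrary: a c M)
  case (Cons I L)
  obtain y where I: "I = (a, y)" "a < y" "chain y b L"
    using Cons.prems by (cases I) auto
  obtain J M' where M: "M = J # M'" using Cons.prems by (cases M) auto
  obtain y' where J: "J = (c, y')" "c < y'" "chain y' d M'"
    using Cons.prems M by (cases J) auto
  obtain g where g: "list_all2 (maps_onto g) L M'"
    using Cons.IH[OF I(3) J(3)] Cons.prems M by auto
  \<comment> \<open>At \<open>y\<close> itself the value comes from \<open>g\<close>, except when
    the first piece is also the last one and must include its right endpoint.\<close>
  define f where "f x = (if x < y \<or> L = [] then c + (y' - c) / (y - a) * (x - a) else g x)" for x
  have "g y = y'" if ne: "L \<noteq> []"
  proof -
    obtain v L'' where "L = (y, v) # L''"
      using ne I(3) by (cases L) auto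
    moreover then obtain v' M'' where "M' = (y', v') # M''"
      using J(3) g by (cases M') auto
    ultimately show ?thesis using g maps_onto_ends by fastforce
  qed
  then have "maps_onto f I J"
    using I J by (auto simp: f_def)
  moreover have "list_all2 (maps_onto f) L M'"
    using g
  proof (rule list.rel_mono_strong)
    fix p q assume "p \<in> set L" and pq: "maps_onto g p q"
    then have "y \<le> fst p" "L \<noteq> []" using chain_bounds[OF I(3), of "fst p" "snd p"] by auto
    then show "maps_onto f p q" using pq by (cases p; cases q) (auto simp: f_def)
  qed
  ultimately show ?case using M by auto
qed auto

text \<open>Continuity and monotonicity pass from the pieces to their union. The value at
  \<open>a\<close> is assumed because an empty list of pieces says nothing about
  \<open>f\<close>.\<close>

lemma maps_onto_chain_homeomorphic:
  assumes "list_all2 (maps_onto f) L M" "chain a b L" "chain c d M" "f a = c"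
  shows "f b = d \<and> continuous_on {a..b} f \<and> strict_mono_on {a..b} f"
  using assms
proof (induction L arbitrary: a c M)
  case (Cons I L)
  obtain y where I: "I = (a, y)" "a < y" "chain y b L"
    using Cons.prems by (cases I) auto
  obtain J M' where M: "M = J # M'" using Cons.prems by (cases M) auto
  obtain y' where J: "J = (c, y')" "c < y'" "chain y' d M'"
    using Cons.prems M by (cases J) auto
  have f: "maps_onto f (a, y) (c, y')" using Cons.prems M I J by simp
  then have fy: "f y = y'" using maps_onto_ends by blast
  have IH: "f b = d" "continuous_on {y..b} f" "strict_mono_on {y..b} f"
    using Cons.IH[OF _ I(3) J(3) fy] Cons.prems M by auto
  have "y \<le> b" using chain_le I by blast
  have "continuous_on {a..y} (\<lambda>x. c + (y' - c) / (y - a) * (x - a))"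
    by (intro continuous_intros)
  then have "continuous_on {a..y} f"
    by (rule continuous_on_cong[THEN iffD1, rotated -1]) (use f in auto)
  then have "continuous_on ({a..y} \<union> {y..b}) f"
    using IH by (intro continuous_on_closed_Un) auto
  moreover have "{a..y} \<union> {y..b} = {a..b}" using I \<open>y \<le> b\<close> by auto
  moreover have low: "f u < f v" if "a \<le> u" "u < v" "v \<le> y" for u v
    using f that I J by (auto intro!: divide_strict_right_mono mult_strict_left_mono)
  have "strict_mono_on {a..b} f"
  proof (rule strict_mono_onI)
    fix u v assume uv: "u \<in> {a..b}" "v \<in> {a..b}" "u < v"
    have up: "y \<le> u \<Longrightarrow> u < v \<Longrightarrow> v \<le> b \<Longrightarrow> f u < f v" for u v
      using IH(3) by (auto simp: strict_mono_on_def)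
    \<comment> \<open>Points on different sides of \<open>y\<close> are compared through
      \<open>f y\<close>.\<close>
    show "f u < f v"
      using uv low[of u v] up[of u v] low[of u y] up[of y v]
      by (cases "v \<le> y"; cases "y \<le> u"; cases "u = y"; cases "v = y"; force)
  qed
  ultimately show ?case using IH by simp
next
  case Nil
  then have "a = b" "c = d" by auto
  moreover have "strict_mono_on {b..b} f" by (rule strict_mono_onI) auto
  ultimately show ?case using Nil.prems(4) by simp
qed

lemma exists_carries:
  assumes "chain 0 1 L" "chain 0 1 M" "length L = length M"
  shows "\<exists>f. carries f L M"
proof -
  obtain g where g: "list_all2 (maps_onto g) L M" using exists_maps_onto assms by blast
  define f where "f x = (if x \<in> {0..1} then g x else x)" for x
  have "list_all2 (maps_onto f) L M"
    using g
  proof (rule list.rel_mono_strong)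
    fix p q assume "p \<in> set L" and pq: "maps_onto g p q"
    then have "0 \<le> fst p" "snd p \<le> 1" 
      using chain_bounds[OF assms(1), of "fst p" "snd p"] by auto
    then show "maps_onto f p q" using pq by (cases p; cases q) (auto simp: f_def)
  qed
  then have "carries f L M" by (auto simp: carries_def f_def)
  then show ?thesis by blast
qed

lemma carries_homeomorphic:
  assumes "carries f L M" "chain 0 1 L" "chain 0 1 M"
  shows "continuous_on {0..1} f" "strict_mono_on {0..1} f" "f ` {0..1} = {0..1}"
proof -
  \<comment> \<open>The first pieces of both partitions start at 0, which yields
    \<open>f 0 = 0\<close>, the initial value needed for gluing.\<close>
  obtain v L' where L: "L = (0, v) # L'" using assms(2) by (cases L) auto
  moreover obtain v' M' where M: "M = (0, v') # M'" using assms(3) by (cases M) auto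
  ultimately have "f 0 = 0"
    using assms(1) maps_onto_ends[of f 0 v 0 v'] by (simp add: carries_def)
  then have f: "f 0 = 0" "f 1 = 1" "continuous_on {0..1} f" "strict_mono_on {0..1} f"
    using maps_onto_chain_homeomorphic[of f L M 0 1 0 1] assms by (auto simp: carries_def)
  then show "continuous_on {0..1} f" "strict_mono_on {0..1} f" by auto
  have "f x \<in> {0..1}" if "x \<in> {0..1}" for x
    using strict_mono_on_leD[OF f(4), of 0 x] strict_mono_on_leD[OF f(4), of x 1] f that by auto
  moreover have "\<exists>x\<in>{0..1}. f x = y" if "y \<in> {0..1}" for y
    using IVT'[of f 0 y 1] f that by auto
  ultimately show "f ` {0..1} = {0..1}" by blast
qed

section \<open>Attaching trees\<close>

lemma length_attach_list [simp]: "length (attach_list U i ts) = length ts"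
  by (induction ts arbitrary: i) auto

lemma proper_attach:
  shows "proper U \<Longrightarrow> proper T \<Longrightarrow> proper (attach U i T)"
    and "proper U \<Longrightarrow> \<forall>t\<in>set ts. proper t \<Longrightarrow> \<forall>t\<in>set (attach_list U i ts). proper t"
  by (induction U i T and U i ts rule: attach_attach_list.induct)
    (auto simp flip: length_greater_0_conv)

text \<open>Attaching a tree below a caret keeps the number of its children and hence the step
  \<open>h\<close>; so only the interval of leaf \<open>i\<close> is refined.\<close>

lemma leaf_intervals_attach:
  shows "i < num_leaves T \<Longrightarrow> \<exists>P x y Q. length P = i \<and> leaf_intervals a b T = P @ (x, y) # Q \<and>
      leaf_intervals a b (attach U i T) = P @ leaf_intervals x y U @ Q"
    and "i < sum_list (map num_leaves ts) \<Longrightarrow> \<exists>P x y Q. length P = i \<and>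
      subdivide c h ts = P @ (x, y) # Q \<and>
      subdivide c h (attach_list U i ts) = P @ leaf_intervals x y U @ Q"
proof (induction U i T and U i ts arbitrary: a b and c h rule: attach_attach_list.induct)
  case (1 U i)
  then show ?case by auto
next
  case (2 U i ts)
  then show ?case by (simp add: leaf_intervals_Caret)
next
  case (3 U i)
  then show ?case by simp
next
  case (4 U i t ts)
  show ?case
  proof (cases "i < num_leaves t")
    case True
    then obtain P x y Q where "length P = i" "leaf_intervals c (c + h) t = P @ (x, y) # Q"
      "leaf_intervals c (c + h) (attach U i t) = P @ leaf_intervals x y U @ Q"
      using 4(1) by blast
    then show ?thesis
      using True
      by (intro exI[of _ P] exI[of _ x] exI[of _ y] exI[of _ "Q @ subdivide (c + h) h ts"]) simp
  next
    case False
    then have "i - num_leaves t < sum_list (map num_leaves ts)" using 4(3) by auto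
    then obtain P x y Q where "length P = i - num_leaves t"
      "subdivide (c + h) h ts = P @ (x, y) # Q"
      "subdivide (c + h) h (attach_list U (i - num_leaves t) ts) = P @ leaf_intervals x y U @ Q"
      using 4(2)[OF False] by blast
    then show ?thesis
      using False
      by (intro exI[of _ "leaf_intervals c (c + h) t @ P"] exI[of _ x] exI[of _ y] exI[of _ Q])
        simp
  qed
qed

lemma num_leaves_attach:
  assumes "i < num_leaves T"
  shows "num_leaves (attach U i T) = num_leaves T - 1 + num_leaves U"
proof -
  obtain P x y Q where "leaf_intervals 0 1 T = P @ (x, y) # Q"
    "leaf_intervals 0 1 (attach U i T) = P @ leaf_intervals x y U @ Q"
    using leaf_intervals_attach(1)[OF assms] by blast
  from this[THEN arg_cong[where f = length]] show ?thesis by simp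
qed

lemma num_leaves_caret [simp]: "num_leaves (caret m) = m"
  by (simp add: caret_def sum_list_replicate)

lemma proper_caret: "m > 0 \<Longrightarrow> proper (caret m)"
  by (auto simp: caret_def)

lemma num_leaves_right_string [simp]: "num_leaves (right_string m c) = c * (m - 1) + 1"
  by (induction c) (auto simp: sum_list_replicate)

lemma proper_right_string: "proper (right_string m c)"
  by (induction c) auto

text \<open>Longer strings only refine the last interval of shorter ones. One choice of
  \<open>P\<close>, \<open>x\<close> and \<open>y\<close> serves all \<open>d\<close>, so the case
  \<open>d = 0\<close> identifies \<open>(x, y)\<close> as the last interval of the string with
  \<open>c\<close> carets.\<close>

lemma right_string_extend:
  "\<exists>P x y. length P = c * (m - 1) \<and>
    (\<forall>d. leaf_intervals a b (right_string m (c + d)) = P @ leaf_intervals x y (right_string m d))"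
proof (induction c arbitrary: a b)
  case 0
  show ?case by auto
next
  case (Suc c)
  \<comment> \<open>The denominator is the number of children of the top caret of the string:
    \<open>m - 1\<close> leaves and the rest of the string.\<close>
  define h where "h = (b - a) / real (m - 1 + 1)"
  define a' where "a' = a + real (m - 1) * h"
  obtain P x y where P: "length P = c * (m - 1)"
    "\<And>d. leaf_intervals a' (a' + h) (right_string m (c + d)) =
      P @ leaf_intervals x y (right_string m d)"
    using Suc by blast
  have "leaf_intervals a b (right_string m (Suc c + d)) =
      (subdivide a h (replicate (m - 1) Leaf) @ P) @ leaf_intervals x y (right_string m d)" for d
    using P(2)[of d] by (simp add: leaf_intervals_Caret subdivide_append h_def a'_def)
  moreover have "length (subdivide a h (replicate (m - 1) Leaf) @ P) = Suc c * (m - 1)"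
    using P by (simp add: sum_list_replicate)
  ultimately show ?case by blast
qed

text \<open>Justifies the definite description in \<open>diagram_element\<close>.\<close>

lemma represents_ex1:
  assumes "proper S" "proper T" "num_leaves S = num_leaves T"
  shows "\<exists>!f. represents (S, T) f"
proof -
  have "chain 0 1 (leaf_intervals 0 1 S)" "chain 0 1 (leaf_intervals 0 1 T)"
    using assms by (auto intro: chain_leaf_intervals)
  then show ?thesis
    using exists_carries carries_unique assms
    by (auto simp: represents_iff_carries[OF assms])
qed

lemma diagram_element_carries:
  assumes "proper S" "proper T" "num_leaves S = num_leaves T"
  shows "carries (diagram_element (S, T)) (leaf_intervals 0 1 S) (leaf_intervals 0 1 T)"
  using theI'[OF represents_ex1[OF assms]]
  by (simp add: diagram_element_def represents_iff_carries[OF assms])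

section \<open>Multiplication by generators\<close>

locale caret_arities =
  fixes n :: "nat \<Rightarrow> nat" and k :: nat
  assumes k_pos: "k \<ge> 1"
    and arity_ge: "j \<in> {1..k} \<Longrightarrow> n j \<ge> 2"
    and arity_dvd: "j \<in> {1..k} \<Longrightarrow> n 1 - 1 dvd n j - 1"
begin

abbreviation str :: "nat \<Rightarrow> tree" where "str \<equiv> right_string (n 1)"

abbreviation ivs :: "tree \<Rightarrow> (real \<times> real) list" where "ivs \<equiv> leaf_intervals 0 1"

text \<open>An \<open>n j\<close>-ary caret adds as many leaves as this number of
  \<open>n 1\<close>-ary carets, so the domain string grows by \<open>ratio j\<close> when one is
  attached to the range tree.\<close>

definition ratio :: "nat \<Rightarrow> nat" where "ratio j = (n j - 1) div (n 1 - 1)"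

lemma n1_ge: "n 1 \<ge> 2"
  using arity_ge k_pos by simp

lemma ratio_mult: "j \<in> {1..k} \<Longrightarrow> ratio j * (n 1 - 1) = n j - 1"
  unfolding ratio_def using arity_dvd by simp

lemma proper_is_tree: "is_tree n k T \<Longrightarrow> proper T"
proof (induction T)
  case (Caret ts)
  then have "length ts \<ge> 2" using arity_ge by auto
  then show ?case using Caret by auto
qed simp

text \<open>Covers both families of generators: \<open>gen_y\<close> attaches at the last leaf, with
  number \<open>c * (n 1 - 1)\<close>, and \<open>gen_z\<close> at an earlier one. The domain string
  is found by counting leaves.\<close>

lemma string_diagram_carries:
  assumes j: "j \<in> {1..k}" and i: "i \<le> c * (n 1 - 1)"
  defines "T \<equiv> attach (caret (n j)) i (str c)"
  shows "carries (diagram_element (string_like n T, T)) (ivs (str (c + ratio j))) (ivs T)"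
proof -
  have "num_leaves T = c * (n 1 - 1) + n j"
    using i by (simp add: T_def num_leaves_attach)
  then have T: "num_leaves T - 1 = (c + ratio j) * (n 1 - 1)" "num_leaves T \<ge> 1"
    using ratio_mult[OF j] arity_ge[OF j] by (auto simp: add_mult_distrib simp del: One_nat_def)
  then have S: "string_like n T = str (c + ratio j)"
    using n1_ge by (simp add: string_like_def)
  have "proper T"
    using arity_ge[OF j] by (auto simp: T_def intro!: proper_attach(1) proper_caret proper_right_string)
  then show ?thesis
    using diagram_element_carries[of "str (c + ratio j)" T] T S
    by (simp add: proper_right_string)
qed

text \<open>The range tree of the generator refines exactly the last interval of the domain string
  of \<open>f\<close>, and \<open>f\<close> transports this refinement to (a,b).\<close>

lemma carries_comp_gen_y:
  assumes j: "j \<in> {1..k}" and f: "carries f (ivs (str i)) (P @ [(a, b)])"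
  shows "carries (f \<circ> gen_y n j i) (ivs (str (i + ratio j)))
    (P @ leaf_intervals a b (caret (n j)))"
proof -
  define T where "T = attach (caret (n j)) (num_leaves (str i) - 1) (str i)"
  obtain P' x y Q where P: "length P' = num_leaves (str i) - 1" "ivs (str i) = P' @ (x, y) # Q"
    "ivs T = P' @ leaf_intervals x y (caret (n j)) @ Q"
    using leaf_intervals_attach(1)[of "num_leaves (str i) - 1" "str i" 0 1 "caret (n j)"]
    unfolding T_def by auto
  \<comment> \<open>The caret sits at the last leaf of the string, so no interval follows.\<close>
  have "length (P' @ (x, y) # Q) = i * (n 1 - 1) + 1" unfolding P(2)[symmetric] by simp
  then have [simp]: "Q = []" using P(1) by simp
  have "length P' = length P" using carries_length[OF f] P by simp
  then have "carries f (ivs T) (P @ leaf_intervals a b (caret (n j)))"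
    using carries_refine[of f P' x y "[]" P a b "[]" "caret (n j)"] f P proper_caret arity_ge[OF j]
    by simp
  moreover have "carries (gen_y n j i) (ivs (str (i + ratio j))) (ivs T)"
    using string_diagram_carries[OF j, of "i * (n 1 - 1)" i] by (simp add: gen_y_def T_def Let_def)
  ultimately show ?thesis by (rule carries_comp)
qed

text \<open>The domain string of \<open>f\<close> may be longer than the string in the generator's
  diagram; since leaf \<open>length P\<close> is not the last, it is never shorter. So the
  generator's diagram is first extended at its last leaf and then composed with
  \<open>f\<close>.\<close>

lemma carries_comp_gen_z:
  assumes j: "j \<in> {1..k}" and f: "carries f (ivs (str c)) (P @ (a, b) # Q)"
    and Q: "Q \<noteq> []"
  shows "carries (f \<circ> gen_z n j (length P)) (ivs (str (c + ratio j)))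
    (P @ leaf_intervals a b (caret (n j)) @ Q)"
proof -
  let ?i = "length P"
  \<comment> \<open>The least number of carets for which leaf \<open>?i\<close> of the string is not
    the last leaf.\<close>
  define c0 where "c0 = ?i div (n 1 - 1) + 1"
  define T where "T = attach (caret (n j)) ?i (str c0)"
  have i: "?i < c0 * (n 1 - 1)"
    using n1_ge dividend_less_div_times[of "n 1 - 1" ?i] by (simp add: c0_def)
  have "c * (n 1 - 1) + 1 = ?i + 1 + length Q" using carries_length[OF f] by simp
  then have "?i < c * (n 1 - 1)" using Q by (cases Q) auto
  then have "?i div (n 1 - 1) < c" using n1_ge by (simp add: div_less_iff_less_mult)
  then obtain d where d: "c = c0 + d" by (metis Suc_eq_plus1 Suc_leI c0_def le_Suc_ex)
  obtain P0 x y where P0: "length P0 = c0 * (n 1 - 1)"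
    "\<And>d. ivs (str (c0 + d)) = P0 @ leaf_intervals x y (str d)"
    using right_string_extend[of c0 "n 1" 0 1] by blast
  obtain P1 u v Q1 where P1: "length P1 = ?i" "ivs (str c0) = P1 @ (u, v) # Q1"
    "ivs T = P1 @ leaf_intervals u v (caret (n j)) @ Q1"
    using leaf_intervals_attach(1)[of ?i "str c0" 0 1 "caret (n j)"] i unfolding T_def by auto
  \<comment> \<open>\<open>(x, y)\<close> is the last interval of \<open>str c0\<close>, where
    longer strings grow. Leaf \<open>?i\<close> comes strictly before it, so \<open>Q1\<close> ends
    in \<open>(x, y)\<close>.\<close>
  have "P0 @ [(x, y)] = P1 @ (u, v) # Q1" using P0(2)[of 0] P1(2) by simp
  then obtain Q2 where Q2: "Q1 = Q2 @ [(x, y)]" "P0 = P1 @ (u, v) # Q2"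
    using P0(1) P1(1) i by (cases Q1 rule: rev_cases) auto
  obtain P' x' y' where P': "length P' = (c0 + ratio j) * (n 1 - 1)"
    "\<And>d. ivs (str (c0 + ratio j + d)) = P' @ leaf_intervals x' y' (str d)"
    using right_string_extend[of "c0 + ratio j" "n 1" 0 1] by blast
  have z: "carries (gen_z n j ?i) (P' @ [(x', y')])
      (P1 @ leaf_intervals u v (caret (n j)) @ Q2 @ [(x, y)])"
    using string_diagram_carries[OF j less_imp_le[OF i]] P'(2)[of 0] P1(3) Q2(1)
    unfolding gen_z_def Let_def T_def c0_def[symmetric] by simp
  \<comment> \<open>The last intervals correspond, so \<open>str d\<close> can be attached to both
    without changing the element; the range side then refines \<open>str c\<close> at leaf
    \<open>?i\<close> alone.\<close>
  have "length P' = length (P1 @ leaf_intervals u v (caret (n j)) @ Q2)"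
    using carries_length[OF z] by simp
  then have "carries (gen_z n j ?i) (P' @ leaf_intervals x' y' (str d))
      (P1 @ leaf_intervals u v (caret (n j)) @ Q2 @ leaf_intervals x y (str d))"
    using carries_refine[of "gen_z n j ?i" P' x' y' "[]"
        "P1 @ leaf_intervals u v (caret (n j)) @ Q2" x y "[]" "str d"] z
    by (simp add: proper_right_string)
  then have "carries (gen_z n j ?i) (ivs (str (c + ratio j)))
      (P1 @ leaf_intervals u v (caret (n j)) @ Q2 @ leaf_intervals x y (str d))"
    using P'(2)[of d] by (simp add: d ac_simps)
  moreover have "carries f (P1 @ leaf_intervals u v (caret (n j)) @ Q2 @ leaf_intervals x y (str d))
      (P @ leaf_intervals a b (caret (n j)) @ Q)"
    using carries_refine[of f P1 u v _ P a b Q "caret (n j)"] f P0(2)[of d] Q2 P1(1)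
      proper_caret arity_ge[OF j] d
    by simp
  ultimately show ?thesis by (rule carries_comp[rotated])
qed

section \<open>Membership in the group\<close>

lemma slope_group_one: "1 \<in> slope_group n k"
  unfolding slope_group_def by (rule image_eqI[of _ _ "\<lambda>_. 0"]) auto

text \<open>Slopes are quotients of interval lengths, and lengths arise by division by arities;
  hence closure under division.\<close>

lemma slope_group_divide:
  assumes "x \<in> slope_group n k" "y \<in> slope_group n k"
  shows "x / y \<in> slope_group n k"
proof -
  obtain p q where "x = (\<Prod>j\<in>{1..k}. real (n j) powi p j)" "y = (\<Prod>j\<in>{1..k}. real (n j) powi q j)"
    using assms unfolding slope_group_def by auto
  then have "x / y = (\<Prod>j\<in>{1..k}. real (n j) powi (p j - q j))"
    using arity_ge by (force simp: power_int_diff prod_dividef[symmetric] intro!: prod.cong)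
  then show ?thesis unfolding slope_group_def by auto
qed

lemma slope_group_arity:
  assumes "j \<in> {1..k}"
  shows "real (n j) \<in> slope_group n k"
proof -
  have "(\<Prod>i\<in>{1..k}. real (n i) powi (if i = j then 1 else 0)) =
      (\<Prod>i\<in>{1..k}. if i = j then real (n j) else 1)"
    by (rule prod.cong) auto
  then have "(\<Prod>i\<in>{1..k}. real (n i) powi (if i = j then 1 else 0)) = real (n j)"
    using assms by simp
  then show ?thesis
    unfolding slope_group_def by (intro range_eqI[of _ _ "\<lambda>i. if i = j then 1 else 0"]) (rule sym)
qed

lemma break_ring_of_int: "of_int c \<in> break_ring n k"
  unfolding break_ring_def by (rule CollectI, rule exI[of _ c], rule exI[of _ 0]) simp

lemma break_ring_add:
  assumes "x \<in> break_ring n k" "y \<in> break_ring n k"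
  shows "x + y \<in> break_ring n k"
proof -
  define N where "N = (\<Prod>j\<in>{1..k}. n j)"
  have "N \<noteq> 0" unfolding N_def using arity_ge by fastforce
  obtain c m d l where xy: "x = of_int c / real N ^ m" "y = of_int d / real N ^ l"
    using assms by (auto simp: break_ring_def N_def)
  have "x + y = of_int (c * int N ^ l + d * int N ^ m) / real N ^ (m + l)"
    unfolding xy using \<open>N \<noteq> 0\<close> by (simp add: field_simps power_add)
  then show ?thesis unfolding break_ring_def N_def by blast
qed

text \<open>Expanding the fraction by the product \<open>r\<close> of the other parameters completes
  one more factor \<open>N\<close> in the denominator.\<close>

lemma break_ring_divide_arity:
  assumes "x \<in> break_ring n k" "j \<in> {1..k}"
  shows "x / real (n j) \<in> break_ring n k"
proof -
  define N where "N = (\<Prod>j\<in>{1..k}. n j)"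
  define r where "r = (\<Prod>i\<in>{1..k} - {j}. n i)"
  have N: "N = n j * r" unfolding N_def r_def using assms(2) by (simp add: prod.remove)
  have "N \<noteq> 0" unfolding N_def using arity_ge by fastforce
  then have r: "r \<noteq> 0" "n j \<noteq> 0" using N by auto
  obtain c m where x: "x = of_int c / real N ^ m"
    using assms by (auto simp: break_ring_def N_def)
  have "x / real (n j) = of_int (c * int r) / real N ^ Suc m"
    unfolding x using r by (simp add: N)
  then show ?thesis unfolding break_ring_def N_def by blast
qed

text \<open>The length of the current interval is tracked in both sets: in the ring to keep the
  endpoints there, in the slope group to get the slopes.\<close>

lemma leaf_intervals_arithmetic:
  assumes "is_tree n k T" "a \<in> break_ring n k" "b - a \<in> break_ring n k" "b - a \<in> slope_group n k"
    and "(u, v) \<in> set (leaf_intervals a b T)"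
  shows "u \<in> break_ring n k \<and> v \<in> break_ring n k \<and> v - u \<in> slope_group n k"
  using assms
proof (induction T arbitrary: a b)
  case Leaf
  then show ?case using break_ring_add[of a "b - a"] by simp
next
  case (Caret ts)
  define h where "h = (b - a) / length ts"
  obtain j where j: "j \<in> {1..k}" "length ts = n j" using Caret.prems by auto
  have h: "h \<in> break_ring n k" "h \<in> slope_group n k"
    using Caret.prems break_ring_divide_arity slope_group_divide slope_group_arity j
    by (auto simp: h_def)
  have "u \<in> break_ring n k \<and> v \<in> break_ring n k \<and> v - u \<in> slope_group n k"
    if "set us \<subseteq> set ts" "c \<in> break_ring n k" "(u, v) \<in> set (subdivide c h us)" for us c
    using that
  proof (induction us arbitrary: c)
    case (Cons w us)
    have "c + h \<in> break_ring n k" using break_ring_add Cons h by blast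
    then show ?case
      using Cons Caret.IH[of w c "c + h"] Caret.prems h by auto
  qed simp
  from this[of ts a] show ?case using Caret.prems by (simp add: leaf_intervals_Caret h_def)
qed

lemma carries_in_carrier:
  assumes "is_tree n k S" "is_tree n k T" "carries f (ivs S) (ivs T)"
  shows "f \<in> carrier (thompson n k)"
proof -
  have ch: "chain 0 1 (ivs S)" "chain 0 1 (ivs T)"
    using assms proper_is_tree by (auto intro!: chain_leaf_intervals)
  note f = carries_homeomorphic[OF assms(3) ch]
  have arith: "u \<in> break_ring n k \<and> v \<in> break_ring n k \<and> v - u \<in> slope_group n k"
    if "is_tree n k U" "(u, v) \<in> set (ivs U)" for U u v
    using leaf_intervals_arithmetic[of U 0 1 u v] that slope_group_one
      break_ring_of_int[of 0] break_ring_of_int[of 1] by simp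
  \<comment> \<open>All endpoints of the domain pieces serve as candidate breakpoints.\<close>
  define P where "P = fst ` set (ivs S) \<union> snd ` set (ivs S)"
  have P: "finite P" "P \<subseteq> break_ring n k" using arith[OF assms(1)] by (auto simp: P_def)
  have "inj_on f {0..1}" using f(2) by (rule strict_mono_on_imp_inj_on)
  then have homeo: "\<exists>g. homeomorphism {0..1} {0..1} f g"
    using homeomorphism_compact[of "{0..1}" f "{0..1}"] f by (metis compact_Icc)
  have aff: "\<exists>m\<in>slope_group n k. \<exists>c. \<forall>x\<in>{a..b}. f x = m * x + c"
    if ab: "0 \<le> a" "a < b" "b \<le> 1" "{a<..<b} \<inter> P = {}" for a b
  proof -
    obtain u v where uv: "(u, v) \<in> set (ivs S)" "u \<le> a" "b \<le> v"
      using chain_covers[OF ch(1) ab(1-3)] ab(4) by (auto simp: P_def)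
    then obtain i where i: "i < length (ivs S)" "ivs S ! i = (u, v)" by (auto simp: in_set_conv_nth)
    obtain p q where pq: "ivs T ! i = (p, q)" by fastforce
    have "i < length (ivs T)" using i carries_length[OF assms(3)] by simp
    then have "(p, q) \<in> set (ivs T)" using pq by (metis nth_mem)
    then have m: "(q - p) / (v - u) \<in> slope_group n k"
      using arith assms uv slope_group_divide by blast
    have "maps_onto f (u, v) (p, q)"
      using assms(3) i pq by (auto simp: carries_def list_all2_conv_all_nth)
    then have "\<forall>x\<in>{a..b}. f x = p + (q - p) / (v - u) * (x - u)"
      using uv by auto
    then have "\<forall>x\<in>{a..b}. f x = (q - p) / (v - u) * x + (p - (q - p) / (v - u) * u)"
      by (simp add: right_diff_distrib)
    then show ?thesis using m by blast
  qed
  have "\<forall>x. x \<notin> {0..1} \<longrightarrow> f x = x" using assms(3) by (simp add: carries_def)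
  moreover have "\<exists>P. finite P \<and> P \<subseteq> break_ring n k \<and>
      (\<forall>a b. 0 \<le> a \<and> a < b \<and> b \<le> 1 \<and> {a<..<b} \<inter> P = {} \<longrightarrow>
        (\<exists>m\<in>slope_group n k. \<exists>c. \<forall>x\<in>{a..b}. f x = m * x + c))"
    using P aff by (intro exI[of _ P]) blast
  ultimately show ?thesis
    unfolding thompson_def using homeo f(2) by simp
qed

end

section \<open>Products along a tree\<close>

lemma size_last_child [termination_simp]:
  "ts \<noteq> [] \<Longrightarrow> size (last ts) < Suc (size_list size ts)"
  by (simp add: last_conv_nth size_nth_child)

text \<open>The trees planted at the leaves of \<open>R(T)\<close> other than the last leaf, from
  left to right; their carets are the non-right carets of \<open>T\<close>.\<close>

fun hanging :: "tree \<Rightarrow> tree list" where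
  "hanging Leaf = []"
| "hanging (Caret ts) = (if ts = [] then [] else butlast ts @ hanging (last ts))"

fun forest_carets :: "nat \<Rightarrow> tree list \<Rightarrow> (nat \<times> nat) list" where
  "forest_carets s [] = []"
| "forest_carets s (t # ts) = carets_with_leaf s t @ forest_carets (s + num_leaves t) ts"

lemma carets_with_leaf_Caret:
  "carets_with_leaf s (Caret ts) = (length ts, s) # forest_carets s ts"
proof -
  have "concat (map (\<lambda>i. carets_with_leaf (s + (\<Sum>j<i. num_leaves (ts ! j))) (ts ! i))
      [0..<length ts]) = forest_carets s ts"
  proof (induction ts arbitrary: s)
    case (Cons t ts)
    have "[0..<length (t # ts)] = 0 # map Suc [0..<length ts]"
      by (simp add: map_Suc_upt upt_conv_Cons del: upt_Suc)
    then show ?case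
      using Cons.IH[of "s + num_leaves t"]
      by (simp add: o_def sum.lessThan_Suc_shift add.assoc del: upt_Suc sum.lessThan_Suc)
  qed simp
  then show ?thesis by simp
qed

declare carets_with_leaf.simps(2) [simp del]

lemma forest_carets_append:
  "forest_carets s (ts @ us) =
    forest_carets s ts @ forest_carets (s + sum_list (map num_leaves ts)) us"
  by (induction ts arbitrary: s) (simp_all add: add.assoc)

lemma forest_carets_replicate_Leaf [simp]: "forest_carets s (replicate m Leaf) = []"
  by (induction m arbitrary: s) auto

lemma right_part_Caret:
  "ts \<noteq> [] \<Longrightarrow>
    right_part (Caret ts) = Caret (replicate (length ts - 1) Leaf @ [right_part (last ts)])"
proof (cases ts rule: rev_cases)
  case (snoc us v)
  have "map (\<lambda>i. if i = length us then right_part ((us @ [v]) ! i) else Leaf) [0..<length us] =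
      replicate (length us) Leaf"
    by (rule nth_equalityI) auto
  then show ?thesis by (simp add: snoc)
qed simp

declare right_part.simps(2) [simp del]

fun graft :: "(real \<times> real) list \<Rightarrow> tree list \<Rightarrow> (real \<times> real) list" where
  "graft ((a, b) # A) (t # ts) = leaf_intervals a b t @ graft A ts"
| "graft _ _ = []"

lemma subdivide_eq_graft:
  "subdivide a h ts = graft (subdivide a h (replicate (length ts) Leaf)) ts"
  by (induction ts arbitrary: a) auto

lemma graft_append:
  "length A = length ts \<Longrightarrow> graft (A @ B) (ts @ us) = graft A ts @ graft B us"
  by (induction A ts rule: list_induct2) auto

text \<open>A tree arises from its right part by planting the hanging trees; the final
  \<open>Leaf\<close> keeps the last leaf as it is.\<close>

lemma leaf_intervals_eq_graft:
  assumes "proper T"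
  shows "leaf_intervals a b T = graft (leaf_intervals a b (right_part T)) (hanging T @ [Leaf]) \<and>
    num_leaves (right_part T) = Suc (length (hanging T))"
  using assms
proof (induction T arbitrary: a b)
  case (Caret ts)
  then obtain us v where ts: "ts = us @ [v]" by (cases ts rule: rev_cases) auto
  define h where "h = (b - a) / length ts"
  define c where "c = a + real (length us) * h"
  have IH: "leaf_intervals c (c + h) v =
      graft (leaf_intervals c (c + h) (right_part v)) (hanging v @ [Leaf])"
    "num_leaves (right_part v) = Suc (length (hanging v))"
    using Caret ts by auto
  have "leaf_intervals a b (Caret ts) = subdivide a h us @ leaf_intervals c (c + h) v"
    by (simp add: leaf_intervals_Caret h_def subdivide_append ts c_def)
  also have "\<dots> = graft (subdivide a h (replicate (length us) Leaf) @
      leaf_intervals c (c + h) (right_part v)) (us @ hanging v @ [Leaf])"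
    by (subst graft_append) (simp_all add: sum_list_replicate IH(1) subdivide_eq_graft[of a h us])
  also have "subdivide a h (replicate (length us) Leaf) @ leaf_intervals c (c + h) (right_part v) =
      leaf_intervals a b (right_part (Caret ts))"
    by (simp add: right_part_Caret leaf_intervals_Caret subdivide_append ts c_def h_def)
  finally show ?case
    using IH(2) by (simp add: ts right_part_Caret sum_list_replicate)
qed simp

context caret_arities
begin

lemma subscript_props:
  assumes "t \<in> n ` {1..k}"
  shows "subscript n k t \<in> {1..k}" "n (subscript n k t) = t"
proof -
  have "\<exists>j. j \<in> {1..k} \<and> n j = t" using assms by auto
  from LeastI_ex[OF this] show "subscript n k t \<in> {1..k}" "n (subscript n k t) = t"
    by (auto simp: subscript_def)
qed

text \<open>One factor per caret, before equal factors are collected into powers.\<close>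

definition z_prod :: "(nat \<times> nat) list \<Rightarrow> real \<Rightarrow> real" where
  "z_prod cs = foldr (\<circ>) (map (\<lambda>(t, l). gen_z n (subscript n k t) l) cs) id"

lemma z_prod_Nil [simp]: "z_prod [] = id"
  and z_prod_Cons: "z_prod ((t, l) # cs) = gen_z n (subscript n k t) l \<circ> z_prod cs"
  by (simp_all add: z_prod_def)

lemma z_prod_append: "z_prod (cs @ ds) = z_prod cs \<circ> z_prod ds"
  by (induction cs) (auto simp: z_prod_Cons comp_assoc)

text \<open>The division converts the number of the leftmost leaf into the index \<beta>.\<close>

definition y_prod :: "(nat \<times> nat) list \<Rightarrow> real \<Rightarrow> real" where
  "y_prod cs = foldr (\<circ>)
    (map (\<lambda>(t, l). gen_y n (subscript n k t) (l div (n 1 - 1))) (filter (\<lambda>(t, l). t \<noteq> n 1) cs)) id"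

lemma y_prod_Nil [simp]: "y_prod [] = id"
  and y_prod_Cons: "y_prod ((t, l) # cs) =
    (if t = n 1 then y_prod cs else gen_y n (subscript n k t) (l div (n 1 - 1)) \<circ> y_prod cs)"
  by (simp_all add: y_prod_def)

text \<open>The first premise is the claim for single trees, so the lemma serves the children of a
  caret inside an induction as well as the trees hanging off the right side. Once \<open>t\<close>
  is in place its leaves join \<open>P\<close>, so \<open>length P\<close> is always the final
  number of the next leaf.\<close>

lemma forest_step:
  assumes "\<And>t f c P a b Q. t \<in> set ts \<Longrightarrow> carries f (ivs (str c)) (P @ (a, b) # Q) \<Longrightarrow> Q \<noteq> [] \<Longrightarrow>
      \<exists>c'. carries (f \<circ> z_prod (carets_with_leaf (length P) t)) (ivs (str c'))
        (P @ leaf_intervals a b t @ Q)"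
    and "carries f (ivs (str c)) (P @ A @ Q)" "length A = length ts" "Q \<noteq> []"
  shows "\<exists>c'. carries (f \<circ> z_prod (forest_carets (length P) ts)) (ivs (str c'))
    (P @ graft A ts @ Q)"
  using assms
proof (induction ts arbitrary: f c P A)
  case (Cons t ts)
  obtain a b A' where A: "A = (a, b) # A'" using Cons.prems(3) by (cases A) auto
  obtain c' where c': "carries (f \<circ> z_prod (carets_with_leaf (length P) t)) (ivs (str c'))
      ((P @ leaf_intervals a b t) @ A' @ Q)"
    using Cons.prems(1)[of t f c P a b "A' @ Q"] Cons.prems(2,4) unfolding A by fastforce
  have "\<exists>c''. carries (f \<circ> z_prod (carets_with_leaf (length P) t) \<circ>
      z_prod (forest_carets (length (P @ leaf_intervals a b t)) ts))
      (ivs (str c'')) ((P @ leaf_intervals a b t) @ graft A' ts @ Q)"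
  proof (rule Cons.IH[OF _ c'])
    fix t f c P a b Q
    assume "t \<in> set ts" "carries f (ivs (str c)) (P @ (a, b) # Q)" "Q \<noteq> []"
    then show "\<exists>c'. carries (f \<circ> z_prod (carets_with_leaf (length P) t)) (ivs (str c'))
        (P @ leaf_intervals a b t @ Q)"
      by (intro Cons.prems(1)) auto
  qed (use Cons.prems A in auto)
  moreover have "f \<circ> z_prod (forest_carets (length P) (t # ts)) =
      f \<circ> z_prod (carets_with_leaf (length P) t) \<circ>
      z_prod (forest_carets (length (P @ leaf_intervals a b t)) ts)"
    by (simp add: z_prod_append fun_eq_iff)
  ultimately show ?case by (simp only: A graft.simps append_assoc)
qed auto

text \<open>The root caret gives one factor; then the trees at its children are planted from left to
  right. This is preorder.\<close>

lemma carries_comp_tree: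
  assumes "is_tree n k t" "carries f (ivs (str c)) (P @ (a, b) # Q)" "Q \<noteq> []"
  shows "\<exists>c'. carries (f \<circ> z_prod (carets_with_leaf (length P) t)) (ivs (str c'))
    (P @ leaf_intervals a b t @ Q)"
  using assms
proof (induction t arbitrary: f c P a b Q)
  case (Caret ts)
  define j where "j = subscript n k (length ts)"
  have j: "j \<in> {1..k}" "n j = length ts"
    using subscript_props Caret.prems(1) by (auto simp: j_def)
  define A where "A = leaf_intervals a b (caret (length ts))"
  have "carries (f \<circ> gen_z n j (length P)) (ivs (str (c + ratio j))) (P @ A @ Q)"
    using carries_comp_gen_z[OF j(1) Caret.prems(2,3)] by (simp add: A_def j)
  then have "\<exists>c'. carries (f \<circ> gen_z n j (length P) \<circ> z_prod (forest_carets (length P) ts))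
      (ivs (str c')) (P @ graft A ts @ Q)"
  proof (rule forest_step[rotated])
    fix t f c P a b Q
    assume t: "t \<in> set ts" "carries f (ivs (str c)) (P @ (a, b) # Q)" "Q \<noteq> []"
    then have "is_tree n k t" using Caret.prems(1) by simp
    then show "\<exists>c'. carries (f \<circ> z_prod (carets_with_leaf (length P) t)) (ivs (str c'))
        (P @ leaf_intervals a b t @ Q)"
      using t by (intro Caret.IH)
  qed (use Caret.prems in \<open>simp_all add: A_def\<close>)
  moreover have "graft A ts = leaf_intervals a b (Caret ts)"
    by (simp add: A_def caret_def leaf_intervals_Caret subdivide_eq_graft[of _ _ ts])
  moreover have "f \<circ> z_prod (carets_with_leaf (length P) (Caret ts)) =
      f \<circ> gen_z n j (length P) \<circ> z_prod (forest_carets (length P) ts)"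
    by (simp add: carets_with_leaf_Caret z_prod_Cons j_def fun_eq_iff)
  ultimately show ?case by (simp only:)
qed auto

text \<open>On the way down the right side, a caret of type other than \<open>n 1\<close> costs one
  factor. An \<open>n 1\<close>-ary caret costs none, since string and range tree grow by the same
  caret and the map is unchanged.\<close>

lemma carries_comp_right_part:
  assumes "is_tree n k T" "carries f (ivs (str c)) (P @ [(a, b)])"
  shows "\<exists>c'. carries (f \<circ> y_prod (carets_with_leaf (length P) (right_part T))) (ivs (str c'))
    (P @ leaf_intervals a b (right_part T))"
  using assms
proof (induction T arbitrary: f c P a b)
  case (Caret ts)
  define j where "j = subscript n k (length ts)"
  have j: "j \<in> {1..k}" "n j = length ts"
    using subscript_props Caret.prems(1) by (auto simp: j_def)
  have ts: "ts \<noteq> []" using proper_is_tree[OF Caret.prems(1)] by simp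
  define h where "h = (b - a) / length ts"
  define P' where "P' = subdivide a h (replicate (length ts - 1) Leaf)"
  define a' where "a' = a + real (length ts - 1) * h"
  have caret: "leaf_intervals a b (caret (length ts)) = P' @ [(a', a' + h)]"
  proof -
    have "replicate (length ts) Leaf = replicate (length ts - 1) Leaf @ [Leaf]"
      using ts by (cases ts) (auto simp: replicate_append_same)
    moreover have "leaf_intervals a b (caret (length ts)) =
        subdivide a h (replicate (length ts) Leaf)"
      by (simp only: caret_def leaf_intervals_Caret h_def length_replicate)
    ultimately show ?thesis by (simp add: subdivide_append P'_def a'_def)
  qed
  have right: "leaf_intervals a b (right_part (Caret ts)) =
      P' @ leaf_intervals a' (a' + h) (right_part (last ts))"
    using ts by (simp add: right_part_Caret leaf_intervals_Caret subdivide_append P'_def a'_def h_def)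
  have len: "length (P @ P') = length P + (length ts - 1)"
    by (simp add: P'_def sum_list_replicate)
  have carets: "carets_with_leaf (length P) (right_part (Caret ts)) =
      (length ts, length P) # carets_with_leaf (length (P @ P')) (right_part (last ts))"
    using ts unfolding len
    by (simp add: right_part_Caret carets_with_leaf_Caret forest_carets_append sum_list_replicate)
  \<comment> \<open>Counting leaves identifies the string length \<open>c\<close> with the index
    prescribed for the factor.\<close>
  have c: "length P = c * (n 1 - 1)" using carries_length[OF Caret.prems(2)] by simp
  define g where "g = (if length ts = n 1 then f else f \<circ> gen_y n j c)"
  have "\<exists>c'. carries g (ivs (str c')) ((P @ P') @ [(a', a' + h)])"
  proof (cases "length ts = n 1")
    case True
    obtain P0 x y where P0: "\<And>d. ivs (str (c + d)) = P0 @ leaf_intervals x y (str d)"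
      using right_string_extend[of c "n 1" 0 1] by blast
    have f: "carries f (P0 @ [(x, y)]) (P @ [(a, b)])"
      using Caret.prems(2) P0[of 0] by simp
    moreover have "length P0 = length P" using carries_length[OF f] by simp
    ultimately have "carries f (P0 @ leaf_intervals x y (str 1)) (P @ leaf_intervals a b (str 1))"
      using carries_refine[of f P0 x y "[]" P a b "[]" "str 1"] by (simp add: proper_right_string)
    moreover have "str 1 = caret (length ts)"
      using n1_ge True by (cases "n 1") (auto simp: caret_def replicate_append_same)
    ultimately have "carries f (ivs (str (c + 1))) (P @ leaf_intervals a b (caret (length ts)))"
      using P0[of 1] by simp
    then have "carries g (ivs (str (c + 1))) ((P @ P') @ [(a', a' + h)])"
      unfolding caret g_def append_assoc if_P[OF True] .
    then show ?thesis by blast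
  next
    case False
    then show ?thesis
      using carries_comp_gen_y[OF j(1) Caret.prems(2)] caret j unfolding g_def by auto
  qed
  then obtain c' where "carries g (ivs (str c')) ((P @ P') @ [(a', a' + h)])" by blast
  then have "\<exists>c'. carries (g \<circ> y_prod (carets_with_leaf (length (P @ P')) (right_part (last ts))))
      (ivs (str c')) ((P @ P') @ leaf_intervals a' (a' + h) (right_part (last ts)))"
    using ts Caret.prems(1) by (intro Caret.IH) auto
  moreover have "f \<circ> y_prod (carets_with_leaf (length P) (right_part (Caret ts))) =
      g \<circ> y_prod (carets_with_leaf (length (P @ P')) (right_part (last ts)))"
  proof -
    have "length P div (n 1 - 1) = c" using c n1_ge by simp
    then show ?thesis by (simp add: carets y_prod_Cons g_def j_def fun_eq_iff)
  qed
  ultimately show ?case by (simp only: right append_assoc)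
qed auto

lemma carries_products:
  assumes T: "is_tree n k T"
  shows "\<exists>c. carries (y_prod (carets_with_leaf 0 (right_part T)) \<circ>
    z_prod (forest_carets 0 (hanging T))) (ivs (str c)) (ivs T)"
proof -
  \<comment> \<open>The construction starts from the identity, represented by two trees without
    carets.\<close>
  have "carries id (ivs (str 0)) ([] @ [(0, 1)])" by (simp add: carries_def)
  from carries_comp_right_part[OF T this] obtain c
    where c: "carries (y_prod (carets_with_leaf 0 (right_part T))) (ivs (str c)) (ivs (right_part T))"
    by auto
  note graft = leaf_intervals_eq_graft[OF proper_is_tree[OF T], of 0 1]
  have "length (ivs (right_part T)) = Suc (length (hanging T))" using graft by simp
  then obtain A p where A: "ivs (right_part T) = A @ [p]" "length A = length (hanging T)"
    by (cases "ivs (right_part T)" rule: rev_cases) auto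
  have trees: "\<And>t. t \<in> set (hanging T) \<Longrightarrow> is_tree n k t"
    using T by (induction T rule: hanging.induct) (auto split: if_splits dest: in_set_butlastD)
  have "carries (y_prod (carets_with_leaf 0 (right_part T))) (ivs (str c)) ([] @ A @ [p])"
    using c A by simp
  then have "\<exists>c'. carries (y_prod (carets_with_leaf 0 (right_part T)) \<circ>
      z_prod (forest_carets (length ([] :: (real \<times> real) list)) (hanging T)))
      (ivs (str c')) ([] @ graft A (hanging T) @ [p])"
    using A(2) trees carries_comp_tree by (intro forest_step) simp_all
  moreover have "ivs T = graft A (hanging T) @ [p]"
    using graft A by (cases p) (auto simp: graft_append)
  ultimately show ?thesis by simp
qed

end

section \<open>Leaf exponent matrices\<close>

lemma runs_fst_in_set: "c \<in> set (runs xs) \<Longrightarrow> fst c \<in> set xs \<and> snd c \<ge> 1"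
  by (induction xs rule: runs.induct) (auto dest: set_dropWhileD)

lemma hd_runs: "xs \<noteq> [] \<Longrightarrow> fst (hd (runs xs)) = hd xs"
  by (cases xs) auto

lemma runs_neq_Nil: "runs xs \<noteq> [] \<longleftrightarrow> xs \<noteq> []"
  by (cases xs) auto

lemma runs_adjacent_distinct:
  "Suc j < length (runs xs) \<Longrightarrow> fst (runs xs ! j) \<noteq> fst (runs xs ! Suc j)"
proof (induction xs arbitrary: j rule: runs.induct)
  case (2 x xs)
  let ?ys = "dropWhile (\<lambda>y. y = x) xs"
  show ?case
  proof (cases j)
    case 0
    then have ne: "runs ?ys \<noteq> []" using 2 by auto
    then have ys: "?ys \<noteq> []" by (simp add: runs_neq_Nil)
    have "fst (hd (runs ?ys)) \<noteq> x" using hd_runs[OF ys] hd_dropWhile[OF ys] by simp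
    then show ?thesis using 0 ne by (auto simp: hd_conv_nth)
  next
    case (Suc j')
    then show ?thesis using 2 by auto
  qed
qed simp

text \<open>The caret types along \<lambda>, root end first and not yet grouped into
  columns.\<close>

definition left_carets :: "(nat \<times> nat \<times> bool) list \<Rightarrow> nat list" where
  "left_carets p = rev (map fst (takeWhile (\<lambda>(m, i, r). i = 0 \<and> \<not> r) (rev p)))"

lemma leaf_exponent_matrix_eq: "leaf_exponent_matrix T l = runs (left_carets (leaf_paths True T ! l))"
  by (simp add: leaf_exponent_matrix_def left_carets_def)

text \<open>Edges are appended at the leaf end: the leftmost edge of a non-right caret prolongs
  \<lambda>, every other edge makes it empty.\<close>

lemma left_carets_simps [simp]:
  "left_carets [] = []"
  "left_carets (p @ [(m, 0, False)]) = left_carets p @ [m]"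
  "i > 0 \<Longrightarrow> left_carets (p @ [(m, i, r)]) = []"
  "left_carets (p @ [(m, i, True)]) = []"
  by (simp_all add: left_carets_def)

text \<open>The columns of all matrices with powers written out as single carets; \<open>s\<close>
  is the number of the first leaf.\<close>

fun labelled :: "nat \<Rightarrow> (nat \<times> nat \<times> bool) list list \<Rightarrow> (nat \<times> nat) list" where
  "labelled s [] = []"
| "labelled s (p # ps) = map (\<lambda>t. (t, s)) (left_carets p) @ labelled (Suc s) ps"

lemma labelled_append: "labelled s (ps @ qs) = labelled s ps @ labelled (s + length ps) qs"
  by (induction ps arbitrary: s) auto

lemma labelled_conv_concat:
  "labelled s ps = concat (map (\<lambda>l. map (\<lambda>t. (t, s + l)) (left_carets (ps ! l))) [0..<length ps])"
proof (induction ps arbitrary: s)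
  case (Cons p ps)
  have "[0..<length (p # ps)] = 0 # map Suc [0..<length ps]"
    by (simp add: map_Suc_upt upt_conv_Cons del: upt_Suc)
  then show ?case by (simp add: Cons o_def del: upt_Suc)
qed simp

fun forest_paths :: "nat \<Rightarrow> bool \<Rightarrow> nat \<Rightarrow> tree list \<Rightarrow> (nat \<times> nat \<times> bool) list list" where
  "forest_paths m r i [] = []"
| "forest_paths m r i (t # ts) =
    map (Cons (m, i, r)) (leaf_paths (r \<and> Suc i = m) t) @ forest_paths m r (Suc i) ts"

lemma leaf_paths_Caret: "leaf_paths r (Caret ts) = forest_paths (length ts) r 0 ts"
proof -
  have "concat (map (\<lambda>i. map (Cons (m, j + i, r)) (leaf_paths (r \<and> Suc (j + i) = m) (ts ! i)))
      [0..<length ts]) = forest_paths m r j ts" for m j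
  proof (induction ts arbitrary: j)
    case (Cons t ts)
    have "[0..<length (t # ts)] = 0 # map Suc [0..<length ts]"
      by (simp add: map_Suc_upt upt_conv_Cons del: upt_Suc)
    then show ?case using Cons.IH[of "Suc j"] by (simp add: o_def del: upt_Suc)
  qed simp
  from this[of "length ts" 0] show ?thesis by simp
qed

declare leaf_paths.simps(2) [simp del]

lemma forest_paths_append:
  "forest_paths m r i (ts @ us) = forest_paths m r i ts @ forest_paths m r (i + length ts) us"
  by (induction ts arbitrary: i) auto

lemma length_leaf_paths [simp]: "length (leaf_paths r T) = num_leaves T"
proof (induction T arbitrary: r)
  case (Caret ts)
  have "(\<And>t. t \<in> set us \<Longrightarrow> t \<in> set ts) \<Longrightarrow>
      length (forest_paths m r i us) = sum_list (map num_leaves us)" for m i us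
    by (induction us arbitrary: i) (auto simp: Caret)
  then show ?case by (simp add: leaf_paths_Caret)
qed simp

lemma length_forest_paths [simp]: "length (forest_paths m r i ts) = sum_list (map num_leaves ts)"
  by (induction ts arbitrary: i) auto

lemma map_append_Cons: "map ((@) p) (map (Cons x) qs) = map ((@) (p @ [x])) qs"
  by simp

text \<open>Treats the children after the first of a non-right caret and those before the last of a
  right caret. The edge to such a child lies on no \<lambda>, so \<open>p\<close> contributes
  nothing and only carets inside the subtrees are listed.\<close>

lemma labelled_forest_paths:
  assumes "\<And>t p s. t \<in> set ts \<Longrightarrow> labelled s (map ((@) p) (leaf_paths False t)) =
      map (\<lambda>x. (x, s)) (left_carets p) @ carets_with_leaf s t"
    and "i > 0 \<or> r" "r \<Longrightarrow> i + length ts < m"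
  shows "labelled s (map ((@) p) (forest_paths m r i ts)) = forest_carets s ts"
  using assms
proof (induction ts arbitrary: i s)
  case (Cons t ts)
  have "left_carets (p @ [(m, i, r)]) = []" using Cons.prems(2) by (cases r) auto
  then have "labelled s (map ((@) (p @ [(m, i, r)])) (leaf_paths False t)) = carets_with_leaf s t"
    by (subst Cons.prems(1)) simp_all
  moreover have "(r \<and> Suc i = m) = False" using Cons.prems(3) by auto
  moreover have "labelled s' (map ((@) p) (forest_paths m r (Suc i) ts)) = forest_carets s' ts" for s'
    using Cons.prems by (intro Cons.IH) auto
  ultimately show ?case
    by (simp only: forest_paths.simps map_append map_append_Cons labelled_append) simp
qed simp

text \<open>
  A non-right caret is the top of exactly one maximal leftmost path, which ends in its leftmost
  leaf. Hence reading the paths leaf by leaf lists the non-right carets in preorder.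
\<close>

lemma labelled_nonright:
  assumes "proper t"
  shows "labelled s (map ((@) p) (leaf_paths False t)) =
    map (\<lambda>x. (x, s)) (left_carets p) @ carets_with_leaf s t"
  using assms
proof (induction t arbitrary: s p)
  case (Caret ts)
  obtain u us where ts: "ts = u # us" using Caret.prems by (cases ts) auto
  define m where "m = length ts"
  have "labelled s' (map ((@) p) (forest_paths m False (Suc 0) us)) =
      forest_carets s' us" for s'
    by (rule labelled_forest_paths) (use Caret ts in auto)
  \<comment> \<open>Only the leftmost child prolongs the path; the current caret is thus listed just
    before the carets of \<open>u\<close>.\<close>
  moreover have "labelled s (map ((@) (p @ [(m, 0, False)])) (leaf_paths False u)) =
      map (\<lambda>x. (x, s)) (left_carets p @ [m]) @ carets_with_leaf s u"
    using Caret.prems ts by (subst Caret.IH) simp_all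
  ultimately show ?case
    unfolding leaf_paths_Caret carets_with_leaf_Caret m_def[symmetric] unfolding ts
    by (simp only: forest_paths.simps map_append map_append_Cons labelled_append) simp
qed simp

text \<open>Edges of right carets lie on no \<lambda>, so only the hanging trees contribute.\<close>

lemma labelled_right:
  assumes "proper T" "left_carets p = []"
  shows "labelled s (map ((@) p) (leaf_paths True T)) = forest_carets s (hanging T)"
  using assms
proof (induction T arbitrary: s p)
  case (Caret ts)
  obtain us v where ts: "ts = us @ [v]" using Caret.prems by (cases ts rule: rev_cases) auto
  let ?m = "length ts"
  have "labelled s (map ((@) p) (forest_paths ?m True 0 us)) = forest_carets s us"
    by (rule labelled_forest_paths) (use Caret.prems ts labelled_nonright in auto)
  moreover have "labelled s' (map ((@) (p @ [(?m, length us, True)])) (leaf_paths True v)) =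
      forest_carets s' (hanging v)" for s'
    using Caret ts by (intro Caret.IH) auto
  moreover have "leaf_paths True (Caret ts) = forest_paths ?m True 0 us @
      map (Cons (?m, length us, True)) (leaf_paths True v)"
    by (simp add: leaf_paths_Caret forest_paths_append ts)
  ultimately show ?case
    by (simp only: map_append map_append_Cons labelled_append)
      (simp add: ts forest_carets_append)
qed simp

context caret_arities
begin

lemma leaf_paths_types:
  assumes "is_tree n k T" "p \<in> set (leaf_paths r T)" "e \<in> set p"
  shows "fst e \<in> n ` {1..k}"
  using assms
proof (induction T arbitrary: r p)
  case (Caret ts)
  have "fst e \<in> n ` {1..k}" if "set us \<subseteq> set ts" "p \<in> set (forest_paths (length ts) r i us)" for i us
    using that
  proof (induction us arbitrary: i)
    case (Cons u us)
    then show ?case using Caret by auto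
  qed simp
  then show ?case using Caret.prems by (auto simp: leaf_paths_Caret)
qed simp

lemma leaf_exponent_matrix_types:
  assumes "is_tree n k T" "l < num_leaves T" "c \<in> set (leaf_exponent_matrix T l)"
  shows "fst c \<in> n ` {1..k}" "snd c \<ge> 1"
proof -
  have "fst c \<in> set (left_carets (leaf_paths True T ! l))" "snd c \<ge> 1"
    using runs_fst_in_set[of c] assms(3) by (simp_all add: leaf_exponent_matrix_eq)
  then obtain e where "e \<in> set (leaf_paths True T ! l)" "fst c = fst e"
    by (auto simp: left_carets_def dest: set_takeWhileD)
  moreover have "leaf_paths True T ! l \<in> set (leaf_paths True T)" using assms(2) by simp
  ultimately show "fst c \<in> n ` {1..k}" using leaf_paths_types[OF assms(1)] by metis
  show "snd c \<ge> 1" by fact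
qed

definition z_value :: "z_word \<Rightarrow> real \<Rightarrow> real" where
  "z_value zs = foldr (\<circ>) (map (\<lambda>(\<epsilon>, \<alpha>, e). gen_z n \<epsilon> \<alpha> ^^ e) zs) id"

lemma z_value_append: "z_value (xs @ ys) = z_value xs \<circ> z_value ys"
  unfolding z_value_def by (induction xs) (auto simp: comp_assoc)

lemma z_prod_same: "z_prod (map (\<lambda>t. (t, l)) (replicate m x)) = gen_z n (subscript n k x) l ^^ m"
  by (induction m) (auto simp: z_prod_Cons)

text \<open>A run of equal types at one leaf is a product of equal factors, hence a power.\<close>

lemma z_value_runs:
  "z_value (map (\<lambda>(t, e). (subscript n k t, l, e)) (runs xs)) = z_prod (map (\<lambda>t. (t, l)) xs)"
proof (induction xs rule: runs.induct)
  case (2 x xs)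
  let ?tw = "takeWhile (\<lambda>y. y = x) xs"
  let ?c = "length ?tw"
  have "?tw = replicate ?c x"
    by (rule replicate_eqI) (auto dest: set_takeWhileD)
  then have "x # xs = replicate (Suc ?c) x @ dropWhile (\<lambda>y. y = x) xs"
    by (metis append_Cons replicate_Suc takeWhile_dropWhile_id)
  then have "z_prod (map (\<lambda>t. (t, l)) (x # xs)) = gen_z n (subscript n k x) l ^^ Suc ?c \<circ>
      z_prod (map (\<lambda>t. (t, l)) (dropWhile (\<lambda>y. y = x) xs))"
    by (metis map_append z_prod_append z_prod_same)
  then show ?case using 2 by (simp add: z_value_def)
qed (simp add: z_value_def)

text \<open>Undoing the grouping into columns leaves one factor per non-right caret, and the order
  leaf by leaf is the preorder.\<close>

lemma z_value_matrices:
  assumes "is_tree n k T"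
    and "zs = concat (map (\<lambda>l. map (\<lambda>(t, e). (subscript n k t, l, e)) (leaf_exponent_matrix T l))
      [0..<num_leaves T])"
  shows "z_value zs = z_prod (forest_carets 0 (hanging T))"
proof -
  have "z_value (concat (map (\<lambda>l. map (\<lambda>(t, e). (subscript n k t, l, e)) (leaf_exponent_matrix T l))
      ls)) = z_prod (concat (map (\<lambda>l. map (\<lambda>t. (t, l)) (left_carets (leaf_paths True T ! l))) ls))"
    for ls
    by (induction ls) (simp_all add: z_value_append z_prod_append z_value_runs
        leaf_exponent_matrix_eq, simp add: z_value_def)
  then have "z_value zs = z_prod (labelled 0 (leaf_paths True T))"
    unfolding assms(2) by (simp add: labelled_conv_concat)
  also have "labelled 0 (leaf_paths True T) = forest_carets 0 (hanging T)"
    using labelled_right[of T "[]" 0] proper_is_tree[OF assms(1)] by (simp add: map_idI)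
  finally show ?thesis .
qed

lemma thompson_pow: "f [^]\<^bsub>thompson n k\<^esub> (e :: nat) = f ^^ e"
  unfolding nat_pow_def
  by (induction e) (simp_all add: thompson_def funpow_Suc_right del: funpow.simps(2))

lemma word_value_eq:
  "word_value n k ys zs = foldr (\<circ>) (map (\<lambda>(\<delta>, \<beta>). gen_y n \<delta> \<beta>) ys) id \<circ> z_value zs"
proof -
  have "foldr (\<circ>) xs (z_value zs) = foldr (\<circ>) xs id \<circ> z_value zs" for xs
    by (induction xs) auto
  moreover have "mult (thompson n k) = (\<circ>)" "\<one>\<^bsub>thompson n k\<^esub> = id"
    by (auto simp: thompson_def)
  ultimately show ?thesis
    by (simp add: word_value_def z_value_def thompson_pow)
qed

section \<open>The shape of the words\<close>

text \<open>Passing a right caret of type \<open>t\<close> moves the leftmost leaf by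
  \<open>t - 1\<close>, a multiple of \<open>n 1 - 1\<close>. The spacing is stated for all pairs,
  not just neighbours, so that it survives the removal of the \<open>n 1\<close>-ary carets.\<close>

lemma right_part_carets:
  assumes "is_tree n k T" "n 1 - 1 dvd s"
  shows "sorted_wrt (\<lambda>(t, l) (t', l'). l + (t - 1) \<le> l') (carets_with_leaf s (right_part T)) \<and>
    (\<forall>(t, l)\<in>set (carets_with_leaf s (right_part T)). s \<le> l \<and> n 1 - 1 dvd l \<and> t \<in> n ` {1..k})"
  using assms
proof (induction T arbitrary: s)
  case (Caret ts)
  have ts: "ts \<noteq> []" using proper_is_tree[OF Caret.prems(1)] by simp
  obtain j where j: "j \<in> {1..k}" "length ts = n j" using Caret.prems(1) by auto
  have "n 1 - 1 dvd s + (length ts - 1)" using Caret.prems(2) arity_dvd[OF j(1)] j by simp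
  then have IH: "sorted_wrt (\<lambda>(t, l) (t', l'). l + (t - 1) \<le> l')
        (carets_with_leaf (s + (length ts - 1)) (right_part (last ts)))"
      "\<forall>(t, l)\<in>set (carets_with_leaf (s + (length ts - 1)) (right_part (last ts))).
        s + (length ts - 1) \<le> l \<and> n 1 - 1 dvd l \<and> t \<in> n ` {1..k}"
    using Caret.IH[of "last ts" "s + (length ts - 1)"] Caret.prems(1) ts by simp_all
  have "carets_with_leaf s (right_part (Caret ts)) =
      (length ts, s) # carets_with_leaf (s + (length ts - 1)) (right_part (last ts))"
    using ts
    by (simp add: right_part_Caret carets_with_leaf_Caret forest_carets_append sum_list_replicate)
  then show ?case using IH Caret.prems by (fastforce simp del: One_nat_def)
qed simp

text \<open>A caret at a child other than the last would be non-right, and every path through it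
  would contain an edge with flag \<open>False\<close>.\<close>

lemma string_of_right_arity:
  assumes "is_tree n k S" "\<forall>p\<in>set (leaf_paths True S). \<forall>(m, i, r)\<in>set p. m = n 1 \<and> r"
  shows "\<exists>c. S = str c"
  using assms
proof (induction S)
  case Leaf
  then show ?case by (metis right_string.simps(1))
next
  case (Caret ts)
  have pr: "proper (Caret ts)" using proper_is_tree[OF Caret.prems(1)] .
  then obtain us v where ts: "ts = us @ [v]" by (cases ts rule: rev_cases) auto
  have mem: "(length ts, i, True) # p \<in> set (leaf_paths True (Caret ts))"
    if "i < length ts" "p \<in> set (leaf_paths (Suc i = length ts) (ts ! i))" for i p
    using that by (auto simp: leaf_paths.simps(2))
  \<comment> \<open>The leaf intervals form a chain from 0 to 1 and so cannot be an empty
    list.\<close>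
  have nonempty: "\<exists>p. p \<in> set (leaf_paths r t)" if "t \<in> set ts" for r t
  proof -
    have "proper t" using that pr by simp
    then have "chain 0 1 (leaf_intervals 0 1 t)" by (simp add: chain_leaf_intervals)
    then have "leaf_intervals 0 1 t \<noteq> []" by auto
    then have "leaf_paths r t \<noteq> []" using length_leaf_intervals length_leaf_paths
      by (metis length_0_conv)
    then show ?thesis by (meson last_in_set)
  qed
  have "length us < length ts" using ts by simp
  from nonempty[of v True] obtain p where "p \<in> set (leaf_paths True v)" using ts by auto
  then have "length ts = n 1" using mem[of "length us" p] Caret.prems(2) ts by fastforce
  have "us ! i = Leaf" if i: "i < length us" for i
  proof (rule ccontr)
    assume "us ! i \<noteq> Leaf"
    then obtain ws where ws: "us ! i = Caret ws" by (cases "us ! i") auto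
    then have "Caret ws \<in> set ts" using i ts by (metis nth_mem in_set_conv_decomp UnCI set_append)
    then obtain p where p: "p \<in> set (leaf_paths False (Caret ws))" using nonempty by blast
    then have "\<exists>q. (length ws, q, False) \<in> set p"
      by (auto simp: leaf_paths.simps(2))
    moreover have "(length ts, i, True) # p \<in> set (leaf_paths True (Caret ts))"
      using mem[of i p] p ws i ts by (auto simp: nth_append)
    ultimately show False using Caret.prems(2) by force
  qed
  then have us: "us = replicate (n 1 - 1) Leaf"
    using \<open>length ts = n 1\<close> ts by (intro nth_equalityI) auto
  have "\<forall>p\<in>set (leaf_paths True v). \<forall>(m, i, r)\<in>set p. m = n 1 \<and> r"
  proof
    fix p assume "p \<in> set (leaf_paths True v)"
    then have "(length ts, length us, True) # p \<in> set (leaf_paths True (Caret ts))"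
      using mem[of "length us" p] ts by auto
    then show "\<forall>(m, i, r)\<in>set p. m = n 1 \<and> r" using Caret.prems(2) by force
  qed
  moreover have "v \<in> set ts" "is_tree n k v" using Caret.prems(1) ts by simp_all
  ultimately obtain c where "v = str c" using Caret.IH by blast
  then have "Caret ts = str (Suc c)" using ts us by simp
  then show ?case by blast
qed

end

section \<open>Positions in a concatenation of blocks\<close>

lemma concat_upt_Suc: "concat (map F [0..<Suc N]) = concat (map F [0..<N]) @ F N"
  by simp

lemma length_concat_upt: "length (concat (map F [0..<N])) = (\<Sum>l<N. length (F l))"
  by (induction N) auto

lemma nth_concat_upt:
  assumes "l < N" "j < length (F l)"
  shows "(\<Sum>l'<l. length (F l')) + j < length (concat (map F [0..<N]))"
    and "concat (map F [0..<N]) ! ((\<Sum>l'<l. length (F l')) + j) = F l ! j"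
proof -
  have "[0..<N] = [0..<l] @ l # [Suc l..<N]"
    using assms(1) upt_add_eq_append[of 0 l "N - l"] by (simp add: upt_conv_Cons)
  then have "concat (map F [0..<N]) = concat (map F [0..<l]) @ F l @ concat (map F [Suc l..<N])"
    by simp
  then show "(\<Sum>l'<l. length (F l')) + j < length (concat (map F [0..<N]))"
    and "concat (map F [0..<N]) ! ((\<Sum>l'<l. length (F l')) + j) = F l ! j"
    using assms(2) by (simp_all add: length_concat_upt nth_append)
qed

lemma concat_upt_index:
  assumes "i < length (concat (map F [0..<N]))"
  obtains l j where "l < N" "j < length (F l)" "i = (\<Sum>l'<l. length (F l')) + j"
    "concat (map F [0..<N]) ! i = F l ! j"
proof -
  have "\<exists>l<N. \<exists>j<length (F l). i = (\<Sum>l'<l. length (F l')) + j"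
    using assms
  proof (induction N)
    case (Suc N)
    show ?case
    proof (cases "i < length (concat (map F [0..<N]))")
      case True
      then show ?thesis using Suc.IH less_SucI by blast
    next
      case False
      then have "i - length (concat (map F [0..<N])) < length (F N)"
        using Suc.prems unfolding concat_upt_Suc by simp
      then show ?thesis
        using False unfolding length_concat_upt
        by (intro exI[of _ N]) (auto intro!: exI[of _ "i - (\<Sum>l'<N. length (F l'))"])
    qed
  qed simp
  then show ?thesis using nth_concat_upt(2) that by metis
qed

text \<open>If \<open>b\<close> were smaller than \<open>a\<close>, all of block \<open>b\<close>
  would lie before block \<open>a\<close>.\<close>

lemma concat_upt_index_mono:
  fixes F :: "nat \<Rightarrow> 'a list" and a b :: nat
  assumes "(\<Sum>l<a. length (F l)) + j \<le> (\<Sum>l<b. length (F l)) + i" "i < length (F b)"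
  shows "a \<le> b"
proof (rule ccontr)
  assume "\<not> a \<le> b"
  then have "(\<Sum>l<Suc b. length (F l)) \<le> (\<Sum>l<a. length (F l))"
    by (intro sum_mono2) auto
  then show False using assms by simp
qed

context caret_arities
begin

text \<open>Block \<open>l\<close> of \<open>zs\<close> holds the columns of leaf \<open>l\<close>.
  Consecutive entries are either neighbouring columns of one matrix, with different types because
  runs are maximal, or belong to different leaves in increasing order.\<close>

lemma z_word_neighbours:
  assumes T: "is_tree n k T" and zs: "z_procedure n k T zs" and i: "Suc i < length zs"
  shows "fst (snd (zs ! i)) \<le> fst (snd (zs ! Suc i))"
    and "fst (snd (zs ! i)) = fst (snd (zs ! Suc i)) \<Longrightarrow> fst (zs ! i) \<noteq> fst (zs ! Suc i)"
    and "fst (snd (zs ! i)) = fst (snd (zs ! Suc i)) \<longleftrightarrow> adjacent_columns n k T zs i"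
proof -
  define col where "col = leaf_exponent_matrix T"
  define F where "F l = map (\<lambda>(t, e). (subscript n k t, l, e)) (col l)" for l
  have z: "zs = concat (map F [0..<num_leaves T])"
    using zs by (simp add: z_procedure_def F_def[abs_def] col_def)
  have len: "length (F l) = length (col l)" for l by (simp add: F_def)
  have F: "F l ! j = (subscript n k (fst (col l ! j)), l, snd (col l ! j))"
    if "j < length (col l)" for l j
    using that by (simp add: F_def case_prod_beta)
  \<comment> \<open>Different types in the matrices therefore have different subscripts.\<close>
  have types: "n (subscript n k (fst (col l ! j))) = fst (col l ! j)"
    if "l < num_leaves T" "j < length (col l)" for l j
    using leaf_exponent_matrix_types(1)[OF T that(1), of "col l ! j"] that(2) subscript_props(2)
    by (simp add: col_def)
  obtain l j where l: "l < num_leaves T" "j < length (F l)" "i = (\<Sum>l'<l. length (F l')) + j"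
    "zs ! i = F l ! j"
    using concat_upt_index[of i F "num_leaves T"] i z by (metis Suc_lessD)
  obtain l' j' where l': "l' < num_leaves T" "j' < length (F l')"
    "Suc i = (\<Sum>m<l'. length (F m)) + j'" "zs ! Suc i = F l' ! j'"
    using concat_upt_index[of "Suc i" F "num_leaves T"] i z by metis
  have le: "l \<le> l'" using concat_upt_index_mono[of F l j l' j'] l l' by simp
  have same: "j' = Suc j" if "l = l'" using that l(3) l'(3) by simp
  have zi: "zs ! i = (subscript n k (fst (col l ! j)), l, snd (col l ! j))"
    and zi': "zs ! Suc i = (subscript n k (fst (col l' ! j')), l', snd (col l' ! j'))"
    using l l' F len by simp_all
  show "fst (snd (zs ! i)) \<le> fst (snd (zs ! Suc i))" using le by (simp add: zi zi')
  show "fst (zs ! i) \<noteq> fst (zs ! Suc i)" if "fst (snd (zs ! i)) = fst (snd (zs ! Suc i))"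
  proof -
    have "l = l'" using that by (simp add: zi zi')
    then have "fst (col l ! j) \<noteq> fst (col l' ! j')"
      using same l'(2) len runs_adjacent_distinct
      by (simp add: col_def leaf_exponent_matrix_eq)
    then show ?thesis using types[of l j] types[of l' j'] l(1,2) l'(1,2) len
      by (auto simp: zi zi')
  qed
  show "fst (snd (zs ! i)) = fst (snd (zs ! Suc i)) \<longleftrightarrow> adjacent_columns n k T zs i"
  proof
    assume "fst (snd (zs ! i)) = fst (snd (zs ! Suc i))"
    then have [simp]: "l' = l" "j' = Suc j" using same by (simp_all add: zi zi')
    have j: "j < length (col l)" "Suc j < length (col l)" using l(2) l'(2) len by simp_all
    have "col l = take j (col l) @ [col l ! j, col l ! Suc j] @ drop (Suc (Suc j)) (col l)"
      using j by (simp add: Cons_nth_drop_Suc)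
    moreover have "i = (\<Sum>m<l. length (col m)) + length (take j (col l))"
      using l(3) j by (simp add: len)
    ultimately have "\<exists>us vs. col l = us @ [col l ! j, col l ! Suc j] @ vs \<and>
        i = (\<Sum>m<l. length (col m)) + length us"
      by blast
    then show "adjacent_columns n k T zs i"
      using types[OF l(1) j(1)] types[OF l(1) j(2)]
      by (simp add: adjacent_columns_def zi zi' col_def)
  next
    assume "adjacent_columns n k T zs i"
    then obtain us c c' vs where us: "col l = us @ [c, c'] @ vs"
        "i = (\<Sum>m<l. length (col m)) + length us"
      unfolding adjacent_columns_def zi zi' col_def[symmetric] by auto
    \<comment> \<open>The index equation puts the two columns at positions \<open>j\<close> and
      \<open>Suc j\<close>, so position \<open>Suc i\<close> still lies in block
      \<open>l\<close>.\<close>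
    then have "length us = j" using l(3) by (simp add: len)
    then have j: "Suc j < length (F l)" using us(1) len by simp
    have "l' \<le> l" using concat_upt_index_mono[of F l' j' l "Suc j"] l(3) l'(3) j by simp
    then show "fst (snd (zs ! i)) = fst (snd (zs ! Suc i))" using le by (simp add: zi zi')
  qed
qed

lemma z_word_entries:
  assumes "is_tree n k T" "z_procedure n k T zs" "(\<epsilon>, \<alpha>, e) \<in> set zs"
  shows "\<epsilon> \<in> {1..k}" "e \<ge> 1"
proof -
  obtain c where "\<alpha> < num_leaves T" "c \<in> set (leaf_exponent_matrix T \<alpha>)"
    "\<epsilon> = subscript n k (fst c)" "e = snd c"
    using assms(2,3) by (auto simp: z_procedure_def)
  then show "\<epsilon> \<in> {1..k}" "e \<ge> 1"
    using leaf_exponent_matrix_types[OF assms(1)] subscript_props(1) by auto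
qed

definition y_word_of :: "tree \<Rightarrow> y_word" where
  "y_word_of T = map (\<lambda>(t, l). (subscript n k t, l div (n 1 - 1)))
    (filter (\<lambda>(t, l). t \<noteq> n 1) (carets_with_leaf 0 (right_part T)))"

text \<open>As \<open>n 1 - 1\<close> is positive, the leaf number
  \<open>(n 1 - 1) * \<beta>\<close> determines \<beta>.\<close>

lemma y_procedure_unique:
  assumes "y_procedure n k T ys" "y_procedure n k T ys'"
  shows "ys = ys'"
proof -
  have "inj (\<lambda>(\<delta> :: nat, \<beta>). (\<delta>, (n 1 - 1) * \<beta>))"
    using n1_ge by (auto intro!: injI)
  then show ?thesis
    using assms unfolding y_procedure_def by (metis inj_map_eq_map)
qed

lemma y_procedure_y_word_of:
  assumes "is_tree n k T"
  shows "y_procedure n k T (y_word_of T)"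
  using right_part_carets[OF assms, of 0] unfolding y_procedure_def y_word_of_def
  by (auto simp del: One_nat_def)

lemma y_word_of_neighbours:
  assumes T: "is_tree n k T" and i: "Suc i < length (y_word_of T)"
  shows "(n (fst (y_word_of T ! i)) - 1) + (n 1 - 1) * snd (y_word_of T ! i) \<le>
    (n 1 - 1) * snd (y_word_of T ! Suc i)"
proof -
  define cs where "cs = filter (\<lambda>(t, l). t \<noteq> n 1) (carets_with_leaf 0 (right_part T))"
  have cs: "sorted_wrt (\<lambda>(t, l) (t', l'). l + (t - 1) \<le> l') cs"
    "\<forall>(t, l)\<in>set cs. n 1 - 1 dvd l \<and> t \<in> n ` {1..k}"
    using right_part_carets[OF T, of 0] by (auto simp: cs_def intro!: sorted_wrt_filter)
  have len: "Suc i < length cs" using i by (simp add: y_word_of_def cs_def)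
  obtain t l t' l' where c: "cs ! i = (t, l)" "cs ! Suc i = (t', l')" by fastforce
  have "l + (t - 1) \<le> l'" using sorted_wrt_nth_less[OF cs(1), of i "Suc i"] len c by simp
  moreover have "(t, l) \<in> set cs" "(t', l') \<in> set cs"
    using c len by (metis nth_mem Suc_lessD)+
  then have "n 1 - 1 dvd l" "n 1 - 1 dvd l'" "n (subscript n k t) = t"
    using cs(2) subscript_props(2) by auto
  ultimately show ?thesis
    using len c unfolding y_word_of_def cs_def[symmetric] by simp
qed

lemma y_word_of_entries:
  assumes "is_tree n k T" "(\<delta>, \<beta>) \<in> set (y_word_of T)"
  shows "\<delta> \<in> {2..k}"
proof -
  obtain t l where "(t, l) \<in> set (carets_with_leaf 0 (right_part T))" "t \<noteq> n 1"
    "\<delta> = subscript n k t"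
    using assms(2) by (auto simp: y_word_of_def)
  moreover then have "t \<in> n ` {1..k}" using right_part_carets[OF assms(1), of 0] by auto
  ultimately have "\<delta> \<in> {1..k}" "n \<delta> \<noteq> n 1" using subscript_props by auto
  moreover then have "\<delta> \<noteq> 1" by auto
  ultimately show ?thesis by auto
qed

lemma word_form_of_tree:
  assumes T: "is_tree n k T" and zs: "z_procedure n k T zs"
  shows "word_form n k (y_word_of T) zs"
  unfolding word_form_def
  using y_word_of_entries[OF T] z_word_entries[OF T zs] y_word_of_neighbours[OF T]
    z_word_neighbours(1,2)[OF T zs]
  by (fastforce simp: Let_def case_prod_beta simp del: One_nat_def)

text \<open>\<open>S\<close> is a string, and the product of generators carries some string to
  \<open>T\<close>. Equal leaf counts make the strings equal, and a map is determined by its two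
  partitions.\<close>

lemma word_value_of_positive:
  assumes D: "is_positive n k (S, T)" and zs: "z_procedure n k T zs"
    and w: "represents (S, T) w"
  shows "word_value n k (y_word_of T) zs = w"
proof -
  have tree: "is_tree n k S" "is_tree n k T" and nl: "num_leaves S = num_leaves T"
    using D by (auto simp: is_positive_def is_diagram_def)
  obtain s where s: "S = str s"
    using string_of_right_arity[OF tree(1)] D by (auto simp: is_positive_def)
  let ?p = "y_prod (carets_with_leaf 0 (right_part T)) \<circ> z_prod (forest_carets 0 (hanging T))"
  obtain c where c: "carries ?p (ivs (str c)) (ivs T)" using carries_products[OF tree(2)] by blast
  have "num_leaves (str c) = num_leaves S" using carries_length[OF c] nl by simp
  then have "c = s" using n1_ge by (simp add: s)
  then have p: "carries ?p (ivs S) (ivs T)" using c s by simp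
  have pr: "proper S" "proper T" using tree proper_is_tree by auto
  then have "carries w (ivs S) (ivs T)" using w represents_iff_carries nl by blast
  then have "w = ?p" using carries_unique[OF _ p] pr chain_leaf_intervals[of 0 1 S] by simp
  moreover have "y_prod (carets_with_leaf 0 (right_part T)) =
      foldr (\<circ>) (map (\<lambda>(\<delta>, \<beta>). gen_y n \<delta> \<beta>) (y_word_of T)) id"
    unfolding y_prod_def y_word_of_def map_map
    by (intro arg_cong[where f = "\<lambda>xs. foldr (\<circ>) xs id"] map_cong) auto
  moreover have "z_value zs = z_prod (forest_carets 0 (hanging T))"
    using z_value_matrices[OF tree(2)] zs by (simp add: z_procedure_def)
  ultimately show ?thesis by (simp add: word_value_eq)
qed

end

section \<open>The order on diagrams and uniqueness of the normal form\<close>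

lemma tree_less_asym: "tree_less S T \<Longrightarrow> \<not> tree_less T S"
proof
  assume "tree_less S T" "tree_less T S"
  then obtain i j where
    i: "take i (caret_types S) = take i (caret_types T)" "caret_types S ! i < caret_types T ! i" and
    j: "take j (caret_types T) = take j (caret_types S)" "caret_types T ! j < caret_types S ! j"
    by (auto simp: tree_less_def)
  show False
  \<comment> \<open>At the smaller of two distinct positions the other comparison demands equal
    entries.\<close>
  proof (cases i j rule: linorder_cases)
    case less
    then show ?thesis using i(2) j(1) by (metis nth_take less_irrefl)
  next
    case equal
    then show ?thesis using i(2) j(2) by simp
  next
    case greater
    then show ?thesis using i(1) j(2) by (metis nth_take less_irrefl)
  qed
qed

lemma diagram_less_asym: "diagram_less D E \<Longrightarrow> \<not> diagram_less E D"
  unfolding diagram_less_def by (metis tree_less_asym)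

text \<open>Of two different candidates, each would precede the other.\<close>

lemma is_unique_minimal_unique:
  "is_unique_minimal n k w D \<Longrightarrow> is_unique_minimal n k w E \<Longrightarrow> D = E"
  unfolding is_unique_minimal_def using diagram_less_asym by metis

theorem theorem4p4:
  fixes n :: "nat \<Rightarrow> nat" and k :: nat and S T :: tree
  assumes "k \<ge> 1"
    and "\<forall>j\<in>{1..k}. n j \<ge> 2"
    and "\<forall>j\<in>{1..k}. (n 1 - 1) dvd (n j - 1)"
    and "is_positive n k (S, T)"
  shows "(\<exists>!w. w \<in> carrier (thompson n k) \<and> represents (S, T) w) \<and>
    (\<forall>w. w \<in> carrier (thompson n k) \<and> represents (S, T) w \<longrightarrow>
      (\<exists>ys zs. y_procedure n k T ys \<and> z_procedure n k T zs \<and>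
        word_form n k ys zs \<and> w = word_value n k ys zs \<and>
        (\<forall>i. Suc i < length zs \<longrightarrow>
          (fst (snd (zs ! i)) = fst (snd (zs ! Suc i)) \<longleftrightarrow> adjacent_columns n k T zs i)) \<and>
        (is_unique_minimal n k w (S, T) \<longrightarrow>
          is_normal_form n k w ys zs \<and>
          (\<forall>ys' zs'. is_normal_form n k w ys' zs' \<longrightarrow> ys' = ys \<and> zs' = zs))))"
proof -
  interpret caret_arities n k
    using assms(1-3) by unfold_locales auto
  have tree: "is_tree n k S" "is_tree n k T" and nl: "num_leaves S = num_leaves T"
    using assms(4) by (auto simp: is_positive_def is_diagram_def)
  have pr: "proper S" "proper T" using tree proper_is_tree by auto
  have ex1: "\<exists>!w. represents (S, T) w" using represents_ex1 pr nl by blast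
  have car: "w \<in> carrier (thompson n k)" if "represents (S, T) w" for w
    using that carries_in_carrier tree represents_iff_carries[OF pr nl] by blast
  obtain zs where zs: "z_procedure n k T zs" by (simp add: z_procedure_def)
  let ?ys = "y_word_of T"
  note ys = y_procedure_y_word_of[OF tree(2)] and form = word_form_of_tree[OF tree(2) zs]
    and val = word_value_of_positive[OF assms(4) zs]
  \<comment> \<open>Any normal form is read off from a unique minimal diagram; this must be
    \<open>(S, T)\<close>, and both procedures determine their words from \<open>T\<close>.\<close>
  have unique: "is_normal_form n k w ?ys zs \<and>
      (\<forall>ys' zs'. is_normal_form n k w ys' zs' \<longrightarrow> ys' = ?ys \<and> zs' = zs)"
    if w: "represents (S, T) w" and m: "is_unique_minimal n k w (S, T)" for w
  proof (intro conjI allI impI)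
    show "is_normal_form n k w ?ys zs"
      unfolding is_normal_form_def using form val[OF w] m assms(4) ys zs by auto
    fix ys' zs'
    assume "is_normal_form n k w ys' zs'"
    then have "y_procedure n k T ys'" "z_procedure n k T zs'"
      using is_unique_minimal_unique[OF m] by (auto simp: is_normal_form_def)
    then show "ys' = ?ys" "zs' = zs"
      using y_procedure_unique ys zs by (auto simp: z_procedure_def)
  qed
  show ?thesis
  proof (intro conjI allI impI)
    show "\<exists>!w. w \<in> carrier (thompson n k) \<and> represents (S, T) w" using ex1 car by blast
    fix w assume w: "w \<in> carrier (thompson n k) \<and> represents (S, T) w"
    show "\<exists>ys zs. y_procedure n k T ys \<and> z_procedure n k T zs \<and>
        word_form n k ys zs \<and> w = word_value n k ys zs \<and>
        (\<forall>i. Suc i < length zs \<longrightarrow>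
          (fst (snd (zs ! i)) = fst (snd (zs ! Suc i)) \<longleftrightarrow> adjacent_columns n k T zs i)) \<and>
        (is_unique_minimal n k w (S, T) \<longrightarrow>
          is_normal_form n k w ys zs \<and>
          (\<forall>ys' zs'. is_normal_form n k w ys' zs' \<longrightarrow> ys' = ys \<and> zs' = zs))"
      using ys zs form val[OF conjunct2[OF w], symmetric] z_word_neighbours(3)[OF tree(2) zs]
        unique[OF conjunct2[OF w]]
      by (intro exI[of _ ?ys] exI[of _ zs] conjI) (assumption | blast)+
  qed
qed

end
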